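(* Let $n \geq 1$, let $x_1, \ldots, x_n > 0$ be real numbers, let $\mu_n = \sum_{i=1}^n \frac{1}{n}\delta_{x_i}$, and let $\hat{\mu}_n$ be the $2$-Wasserstein projection of $\mu_n$ onto $\mathcal{F}_{m,2}$, that is, the unique minimizer of $\nu \mapsto \mathcal{W}_2(\nu, \mu_n)$ over $\nu \in \mathcal{F}_{m,2}$. Then $\hat{\mu}_n$ has a density with respect to Lebesgue measure on $\mathbb{R}_+$, and this density, which is non-increasing, is compactly supported and piecewise constant with finitely many pieces.
   Context: $\mathbb{R}_+ = [0,\infty)$. For $p \ge 1$, $\mathcal{P}_p(\mathbb{R}_+)$ is the set of Borel probability measures on $\mathbb{R}_+$ with finite $p$-th moment. For a Borel probability measure $\mu$ on $\mathbb{R}$, its quantile function is $Q_\mu(u) = \inf\{x \in \mathbb{R} : \mu((-\infty,x]) \ge u\}$, $u \in (0,1)$. The $p$-Wasserstein distance is $\mathcal{W}_p(\mu,\nu) = \left(\inf_{\pi} \int |x-y|^p \, d\pi(x,y)\right)^{1/p}$, the infimum being over all couplings $\pi$ of $\mu$ and $\nu$ (probability measures on $\mathbb{R}\times\mathbb{R}$ with marginals $\mu$ and $\nu$); on $\mathbb{R}$ it equals $\left(\int_0^1 |Q_\mu(u)-Q_\nu(u)|^p\,du\right)^{1/p}$. $\mathcal{F}_{m,2}$ is the set of $\mu \in \mathcal{P}_2(\mathbb{R}_+)$ whose quantile function $Q_\mu$ is convex and non-decreasing on $(0,1)$ with $\lim_{u \downarrow 0} Q_\mu(u) = 0$. The set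 of quantile functions of elements of $\mathcal{F}_{m,2}$ is a closed convex subset of $L^2([0,1])$, so the minimizer in the definition of $\hat\mu_n$ exists and is unique. "Piecewise constant with finitely many pieces" means that there are finitely many points $0 = t_0 < t_1 < \cdots < t_m$ such that the density is a.e. constant on each $(t_{i-1},t_i)$ and vanishes a.e. on $(t_m,\infty)$. *)

theory Defs
  imports "HOL-Probability.Probability"
begin

text \<open>
  A probability measure on the half-line \<open>[0, \<infinity>)\<close> is represented as a Borel probability measure on
  the whole real line which gives no mass to \<open>(-\<infinity>, 0)\<close>.
\<close>

definition prob_nonneg_moment :: "real \<Rightarrow> real measure set" where
  "prob_nonneg_moment p =
     {\<mu>. real_distribution \<mu> \<and> emeasure \<mu> {..<0} = 0 \<and> integrable \<mu> (\<lambda>x. \<bar>x\<bar> powr p)}"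

definition quantile :: "real measure \<Rightarrow> real \<Rightarrow> real" where
  "quantile \<mu> u = Inf {x. cdf \<mu> x \<ge> u}"

definition couplings :: "real measure \<Rightarrow> real measure \<Rightarrow> (real \<times> real) measure set" where
  "couplings \<mu> \<nu> =
     {\<pi>. prob_space \<pi> \<and> sets \<pi> = sets (borel \<Otimes>\<^sub>M borel) \<and>
         distr \<pi> borel fst = \<mu> \<and> distr \<pi> borel snd = \<nu>}"

text \<open>
  The distance takes values in the extended nonnegative reals, so that an infinite transport cost
  is not confused with a finite one; there is no real power on \<open>ennreal\<close> in the library, hence the
  case distinction.
\<close>

definition transport_cost :: "real \<Rightarrow> real measure \<Rightarrow> real measure \<Rightarrow> ennreal" where
  "transport_cost p \<mu> \<nu> =
     (INF \<pi>\<in>couplings \<mu> \<nu>. \<integral>\<^sup>+ (x, y). ennreal (\<bar>x - y\<bar> powr p) \<partial>\<pi>)"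

definition wasserstein :: "real \<Rightarrow> real measure \<Rightarrow> real measure \<Rightarrow> ennreal" where
  "wasserstein p \<mu> \<nu> =
     (if transport_cost p \<mu> \<nu> = \<infinity> then \<infinity>
      else ennreal (enn2real (transport_cost p \<mu> \<nu>) powr (1 / p)))"

definition F_m2 :: "real measure set" where
  "F_m2 = {\<mu> \<in> prob_nonneg_moment 2.
     convex_on {0<..<1} (quantile \<mu>) \<and> mono_on {0<..<1} (quantile \<mu>) \<and>
     (quantile \<mu> \<longlongrightarrow> 0) (at_right 0)}"

definition empirical_measure :: "nat \<Rightarrow> (nat \<Rightarrow> real) \<Rightarrow> real measure" where
  "empirical_measure n x =
     measure_of UNIV (sets borel)
       (\<lambda>A. \<Sum>i=1..n. ennreal (1 / real n) * emeasure (return borel (x i)) A)"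

text \<open>
  The set function above really is a measure, so \<open>measure_of\<close> does not fall back to its default.
\<close>

lemma sets_empirical_measure [simp, measurable_cong]:
  "sets (empirical_measure n x) = sets borel"
  using sets.sigma_sets_eq[of "borel :: real measure"]
  by (simp add: empirical_measure_def)

lemma space_empirical_measure [simp]: "space (empirical_measure n x) = UNIV"
  using sets_eq_imp_space_eq[OF sets_empirical_measure] by simp

lemma emeasure_empirical_measure:
  assumes "A \<in> sets borel"
  shows "emeasure (empirical_measure n x) A =
    (\<Sum>i=1..n. ennreal (1 / real n) * emeasure (return borel (x i)) A)"
proof (rule emeasure_measure_of[OF empirical_measure_def])
  let ?m = "\<lambda>A. \<Sum>i=1..n. ennreal (1 / real n) * emeasure (return borel (x i)) A"
  show "sets borel \<subseteq> Pow (UNIV :: real set)" by simp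
  show "A \<in> sets (empirical_measure n x)" using assms by simp
  show "positive (sets (empirical_measure n x)) ?m" by (simp add: positive_def)
  show "countably_additive (sets (empirical_measure n x)) ?m"
  proof (rule countably_additiveI)
    fix B :: "nat \<Rightarrow> real set"
    assume "range B \<subseteq> sets (empirical_measure n x)" and "disjoint_family B"
    then have "(\<Sum>k. emeasure (return borel (x i)) (B k)) = emeasure (return borel (x i)) (\<Union>k. B k)" for i
      by (intro suminf_emeasure) auto
    then show "(\<Sum>k. ?m (B k)) = ?m (\<Union>k. B k)"
      by (simp add: suminf_sum)
  qed
qed

definition piecewise_constant :: "(real \<Rightarrow> real) \<Rightarrow> bool" where
  "piecewise_constant f \<longleftrightarrow>
     (\<exists>m t. 1 \<le> (m::nat) \<and> t 0 = 0 \<and> strict_mono_on {0..m} t \<and>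
        (\<forall>i\<in>{1..m}. \<exists>c. AE y in lborel. t (i - 1) < y \<and> y < t i \<longrightarrow> f y = c) \<and>
        (AE y in lborel. t m < y \<longrightarrow> f y = 0))"

end

theory Submission
  imports Defs
begin

text \<open>
  On the line the squared distance to the empirical measure is the squared \<open>L\<^sup>2\<close> distance of the
  quantile functions \<open>Q\<close> of the minimizer and \<open>S\<close> of the empirical measure. Hence no other admissible
  quantile function lies pointwise between \<open>Q\<close> and the step function \<open>S\<close>. Competitors of three kinds
  are excluded in this way. The maximum of \<open>Q\<close> and \<open>u \<mapsto> \<epsilon> u\<close>, with \<open>\<epsilon>\<close> the least data point, shows
  \<open>Q u \<ge> \<epsilon> u\<close>, so that there is no atom at \<open>0\<close>. Where \<open>S\<close> is constant and above \<open>Q\<close>, replacing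
  \<open>Q\<close> by a chord shows that \<open>Q\<close> is affine. Where \<open>S\<close> is constant and below \<open>Q\<close>, replacing \<open>Q\<close> by the
  maximum of the tangents at the two ends (by the left one alone on the last interval) shows that \<open>Q\<close>
  is affine with at most one kink. So \<open>Q\<close> is piecewise affine with positive increasing slopes, and
  the density takes the reciprocals of these slopes as its values.
\<close>

section \<open>Convex functions on an interval\<close>

text \<open>The line supporting \<open>f\<close> at the convex combination \<open>w\<close> has the
  value \<open>f w\<close> there and stays below \<open>f\<close> at \<open>x\<close> and
  \<open>y\<close>; averaging gives the inequality. Convexity of a glued function can thus be
  certified one point at a time.\<close>

lemma convex_on_if_supporting_lines:
  fixes f :: "real \<Rightarrow> real"
  assumes "convex S" and "\<And>u. u \<in> S \<Longrightarrow> \<exists>m. \<forall>v\<in>S. f u + m * (v - u) \<le> f v"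
  shows "convex_on S f"
proof (rule convex_onI)
  fix t x y :: real
  assume t: "0 < t" "t < 1" and xy: "x \<in> S" "y \<in> S"
  define w where "w = (1 - t) * x + t * y"
  have "w \<in> S"
    using convexD_alt[OF assms(1) xy, of t] t by (simp add: w_def)
  then obtain m where m: "\<And>v. v \<in> S \<Longrightarrow> f w + m * (v - w) \<le> f v"
    using assms(2) by blast
  have "f w = (1 - t) * (f w + m * (x - w)) + t * (f w + m * (y - w))"
    by (simp add: w_def algebra_simps)
  also have "\<dots> \<le> (1 - t) * f x + t * f y"
    using t m xy by (intro add_mono mult_left_mono) auto
  finally show "f ((1 - t) *\<^sub>R x + t *\<^sub>R y) \<le> (1 - t) * f x + t * f y"
    by (simp add: w_def)
qed (fact assms(1))

lemma convex_on_subgradient: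
  fixes f :: "real \<Rightarrow> real"
  assumes "convex_on {a<..<b} f" "c \<in> {a<..<b}"
  obtains m where "\<And>v. v \<in> {a<..<b} \<Longrightarrow> f c + m * (v - c) \<le> f v"
  using convex_le_Inf_differential[OF assms(1)] assms(2)
  by (metis interior_greaterThanLessThan_real)

lemma convex_on_max:
  fixes f g :: "real \<Rightarrow> real"
  assumes "convex_on S f" "convex_on S g"
  shows "convex_on S (\<lambda>u. max (f u) (g u))"
proof (rule convex_onI)
  fix t x y :: real
  assume t: "0 < t" "t < 1" and xy: "x \<in> S" "y \<in> S"
  have "f ((1 - t) *\<^sub>R x + t *\<^sub>R y) \<le> (1 - t) * f x + t * f y"
    and "g ((1 - t) *\<^sub>R x + t *\<^sub>R y) \<le> (1 - t) * g x + t * g y"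
    using convex_onD[OF assms(1), of t x y] convex_onD[OF assms(2), of t x y] t xy by auto
  moreover have "(1 - t) * f x + t * f y \<le> (1 - t) * max (f x) (g x) + t * max (f y) (g y)"
    and "(1 - t) * g x + t * g y \<le> (1 - t) * max (f x) (g x) + t * max (f y) (g y)"
    using t by (auto intro!: add_mono mult_left_mono)
  ultimately show "max (f ((1 - t) *\<^sub>R x + t *\<^sub>R y)) (g ((1 - t) *\<^sub>R x + t *\<^sub>R y))
      \<le> (1 - t) * max (f x) (g x) + t * max (f y) (g y)"
    by linarith
qed (use assms in \<open>auto simp: convex_on_def\<close>)

lemma convex_on_eq:
  assumes "convex_on S f" "\<And>u. u \<in> S \<Longrightarrow> g u = f u"
  shows "convex_on S g"
  using assms unfolding convex_on_def convex_def by simp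

lemma convex_on_affine_real: "convex S \<Longrightarrow> convex_on S (\<lambda>u::real. c + d * u)"
  by (rule convex_on_if_supporting_lines) (auto intro!: exI[of _ d] simp: algebra_simps)

text \<open>Letting the left end of a chord tend to \<open>0\<close>, where \<open>f\<close> tends
  to \<open>0\<close>, turns the chord bound at \<open>u\<close> into the bound by the segment from
  the origin to \<open>(v, f v)\<close>.\<close>

lemma convex_on_below_ray:
  fixes f :: "real \<Rightarrow> real"
  assumes "convex_on {0<..<1} f" "(f \<longlongrightarrow> 0) (at_right 0)" "0 < u" "u < v" "v < 1"
  shows "f u \<le> u / v * f v"
proof -
  have "((\<lambda>t. (v - u) / (v - t) * f t + (u - t) / (v - t) * f v) \<longlongrightarrow>
      (v - u) / (v - 0) * 0 + (u - 0) / (v - 0) * f v) (at_right 0)"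
    using assms by (intro tendsto_intros) auto
  moreover have "\<forall>\<^sub>F t in at_right 0. f u \<le> (v - u) / (v - t) * f t + (u - t) / (v - t) * f v"
  proof (rule eventually_at_rightI[of 0 u])
    fix t assume t: "t \<in> {0<..<u}"
    define s where "s = (u - t) / (v - t)"
    have s: "0 \<le> s" "s \<le> 1" "1 - s = (v - u) / (v - t)"
      using t assms by (auto simp: s_def field_simps)
    have "f ((1 - s) *\<^sub>R t + s *\<^sub>R v) \<le> (1 - s) * f t + s * f v"
      using assms s t by (intro convex_onD) auto
    moreover have "(1 - s) *\<^sub>R t + s *\<^sub>R v = u"
    proof -
      have "(1 - s) *\<^sub>R t + s *\<^sub>R v = t + s * (v - t)" by (simp add: algebra_simps)
      also have "\<dots> = u" using t assms by (simp add: s_def)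
      finally show ?thesis .
    qed
    ultimately show "f u \<le> (v - u) / (v - t) * f t + (u - t) / (v - t) * f v"
      using s by (simp add: s_def)
  qed (fact assms(3))
  ultimately have "f u \<le> (v - u) / (v - 0) * 0 + (u - 0) / (v - 0) * f v"
    by (intro tendsto_lowerbound) auto
  then show ?thesis by simp
qed

text \<open>The segment from the origin gives the factor \<open>u / v \<le> 1\<close>, and
  \<open>f v\<close> is non-negative. Monotonicity of every competitor comes from here.\<close>

lemma convex_on_nonneg_mono:
  fixes f :: "real \<Rightarrow> real"
  assumes "convex_on {0<..<1} f" "(f \<longlongrightarrow> 0) (at_right 0)" "\<And>u. u \<in> {0<..<1} \<Longrightarrow> 0 \<le> f u"
  shows "mono_on {0<..<1} f"
proof (rule mono_onI)
  fix u v :: real assume uv: "u \<in> {0<..<1}" "v \<in> {0<..<1}" "u \<le> v"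
  show "f u \<le> f v"
  proof (cases "u = v")
    case False
    then have "f u \<le> u / v * f v"
      using uv assms by (intro convex_on_below_ray) auto
    also have "\<dots> \<le> 1 * f v"
      using uv assms by (intro mult_right_mono) auto
    finally show ?thesis by simp
  qed simp
qed

section \<open>Affine pieces, chords and maxima of two lines\<close>

definition affine_between :: "(real \<Rightarrow> real) \<Rightarrow> real \<Rightarrow> real \<Rightarrow> bool" where
  "affine_between f a b \<longleftrightarrow> (\<exists>c d. \<forall>u\<in>{a<..<b}. f u = c + d * u)"

lemma affine_betweenI:
  "(\<And>u. a < u \<Longrightarrow> u < b \<Longrightarrow> f u = c + d * u) \<Longrightarrow> affine_between f a b"
  by (auto simp: affine_between_def)

text \<open>The compact intervals used all contain the reference points \<open>p\<close> and
  \<open>q\<close>, which fix slope and intercept, so the local formulas agree. This serves when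
  chords can only be drawn between interior points.\<close>

lemma affine_between_locally:
  assumes "\<And>c d. a < c \<Longrightarrow> c < d \<Longrightarrow> d < b \<Longrightarrow> \<exists>\<alpha> \<beta>. \<forall>u\<in>{c..d}. f u = \<alpha> + \<beta> * u"
  shows "affine_between f a b"
proof (cases "a < b")
  case True
  define p where "p = a + (b - a) / 3"
  define q where "q = a + 2 * (b - a) / 3"
  have pq: "a < p" "p < q" "q < b" using True by (auto simp: p_def q_def field_simps)
  define s where "s = (f q - f p) / (q - p)"
  have "f u = (f p - s * p) + s * u" if "a < u" "u < b" for u
  proof -
    have "\<exists>\<alpha> \<beta>. \<forall>w\<in>{min u p..max u q}. f w = \<alpha> + \<beta> * w"
      using that pq by (intro assms) auto
    then obtain \<alpha> \<beta> where ab: "\<And>w. w \<in> {min u p..max u q} \<Longrightarrow> f w = \<alpha> + \<beta> * w" by blast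
    have "f u = \<alpha> + \<beta> * u" "f p = \<alpha> + \<beta> * p" "f q = \<alpha> + \<beta> * q"
      using pq by (auto intro!: ab)
    moreover from this have "s = \<beta>" using pq by (simp add: s_def field_simps)
    ultimately show ?thesis by (simp add: algebra_simps)
  qed
  then show ?thesis by (intro affine_betweenI)
qed (auto simp: affine_between_def)

lemma convex_on_chord_inside:
  fixes f :: "real \<Rightarrow> real"
  assumes "convex_on S f" "c \<in> S" "d \<in> S" "c < d" "c \<le> u" "u \<le> d"
  shows "f u \<le> f c + (f d - f c) / (d - c) * (u - c)"
proof -
  have "convex S" using assms(1) by (simp add: convex_on_def)
  then have "{c..d} \<subseteq> S"
    using closed_segment_subset[of c S d] assms by (simp add: closed_segment_eq_real_ivl)
  then have "convex_on {c..d} f"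
    using assms(1) by (auto intro: convex_on_subset)
  from convex_onD_Icc'[OF this, of u] assms show ?thesis by simp
qed

text \<open>Difference quotients of a convex function increase, so a chord prolonged beyond its ends
  runs below the function.\<close>

lemma convex_on_chord_outside:
  fixes f :: "real \<Rightarrow> real"
  assumes "convex_on S f" "c \<in> S" "d \<in> S" "u \<in> S" "c < d" "u < c \<or> d < u"
  shows "f c + (f d - f c) / (d - c) * (u - c) \<le> f u"
proof -
  define s where "s = (f d - f c) / (d - c)"
  from assms(6) have "f c + s * (u - c) \<le> f u"
  proof
    assume "u < c"
    then have "(f u - f c) / (u - c) \<le> (f u - f d) / (u - d)" "(f u - f d) / (u - d) \<le> (f c - f d) / (c - d)"
      using convex_on_slope_le[OF assms(1), of u d c] assms by auto
    moreover have "(f c - f d) / (c - d) = s" using assms by (simp add: s_def divide_simps) (simp add: algebra_simps)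
    ultimately have "(f u - f c) / (u - c) \<le> s" by linarith
    then show ?thesis using \<open>u < c\<close> by (simp add: neg_divide_le_eq)
  next
    assume "d < u"
    then have "(f c - f d) / (c - d) \<le> (f c - f u) / (c - u)"
      using convex_on_slope_le(1)[OF assms(1), of c u d] assms by auto
    moreover have "(f c - f d) / (c - d) = s" using assms by (simp add: s_def divide_simps) (simp add: algebra_simps)
    ultimately have "s \<le> (f c - f u) / (c - u)" by simp
    then show ?thesis using \<open>d < u\<close> assms by (simp add: neg_le_divide_eq algebra_simps)
  qed
  then show ?thesis by (simp add: s_def)
qed

text \<open>The values at \<open>x\<close> and \<open>y\<close> fix the sign of \<open>q\<close>,
  and moving from \<open>x\<close> away from \<open>y\<close> cannot make the function positive. It
  serves to compare a supporting line with a tangent beyond the point of contact of the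
  tangent.\<close>

lemma affine_extrapolate:
  fixes p q :: real
  assumes "p + q * x \<le> 0" "0 \<le> p + q * y" "x < y \<and> w \<le> x \<or> y < x \<and> x \<le> w"
  shows "p + q * w \<le> 0"
proof -
  have "0 \<le> q * (y - x)" using assms(1,2) by (simp add: algebra_simps)
  then have "q * (w - x) \<le> 0"
    using assms(3) by (auto simp: zero_le_mult_iff mult_le_0_iff)
  then show ?thesis using assms(1) by (simp add: algebra_simps)
qed

text \<open>The maximum of two lines has at most one kink, where they cross; an interval avoiding
  that point sees a single line.\<close>

lemma affine_between_max_affine:
  fixes f :: "real \<Rightarrow> real"
  assumes "\<And>u. A < u \<Longrightarrow> u < C \<Longrightarrow> f u = max (p + q * u) (r + s * u)"
  shows "\<exists>k. \<forall>a b. A \<le> a \<longrightarrow> b \<le> C \<longrightarrow> k \<notin> {a<..<b} \<longrightarrow> affine_between f a b"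
proof (intro exI allI impI)
  \<comment> \<open>The witness is the crossing point. For \<open>s = q\<close> the division yields
    \<open>0\<close>, which is harmless as one line then dominates everywhere.\<close>
  fix a b assume ab: "A \<le> a" "b \<le> C" "- (r - p) / (s - q) \<notin> {a<..<b}"
  have "(\<forall>u\<in>{a<..<b}. p + q * u \<le> r + s * u) \<or> (\<forall>u\<in>{a<..<b}. r + s * u \<le> p + q * u)"
  proof (cases "s = q")
    case False
    have "b \<le> - (r - p) / (s - q) \<or> - (r - p) / (s - q) \<le> a" if "a < b" using ab that by auto
    moreover have "p + q * u \<le> r + s * u \<longleftrightarrow> (if q < s then - (r - p) / (s - q) \<le> u else u \<le> - (r - p) / (s - q))"
      and "r + s * u \<le> p + q * u \<longleftrightarrow> (if q < s then u \<le> - (r - p) / (s - q) else - (r - p) / (s - q) \<le> u)" for u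
      using False by (auto simp: field_simps)
    ultimately show ?thesis by (cases "a < b"; cases "q < s") auto
  qed auto
  then show "affine_between f a b"
  proof
    assume "\<forall>u\<in>{a<..<b}. p + q * u \<le> r + s * u"
    then show ?thesis using ab assms by (intro affine_betweenI[of _ _ _ r s]) auto
  next
    assume "\<forall>u\<in>{a<..<b}. r + s * u \<le> p + q * u"
    then show ?thesis using ab assms by (intro affine_betweenI[of _ _ _ p q]) auto
  qed
qed

section \<open>Optimal transport on the half-line\<close>

abbreviation unif01 :: "real measure" where
  "unif01 \<equiv> restrict_space lborel {0<..<1}"

lemma prob_space_unif01: "prob_space unif01"
  by (auto simp: emeasure_restrict_space space_restrict_space intro!: prob_spaceI)

lemma sets_unif01: "sets unif01 = sets (restrict_space borel {0<..<1})"
  by (simp add: sets_restrict_space)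

lemma measurable_unif01:
  "f \<in> borel_measurable (restrict_space borel {0<..<1}) \<Longrightarrow> f \<in> borel_measurable unif01"
  using measurable_cong_sets[OF sets_unif01 refl] by blast

lemma measurable_unif01_mono: "mono_on {0<..<1} (f :: real \<Rightarrow> real) \<Longrightarrow> f \<in> borel_measurable unif01"
  by (intro measurable_unif01 borel_measurable_mono_on_fnc)

lemma AE_unif01I: "(\<And>u. u \<in> {0<..<1} \<Longrightarrow> P u) \<Longrightarrow> AE u in unif01. P u"
  by (intro AE_I2) (simp add: space_restrict_space)

text \<open>Hoeffding's formula, from which the optimality of the monotone coupling follows.\<close>

lemma nn_integral_mult_layer_cake:
  assumes "sigma_finite_measure M" and [measurable]: "X \<in> borel_measurable M" "Y \<in> borel_measurable M"
  shows "(\<integral>\<^sup>+\<omega>. ennreal (X \<omega>) * ennreal (Y \<omega>) \<partial>M) =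
    (\<integral>\<^sup>+s. \<integral>\<^sup>+t. indicator {0..} s * indicator {0..} t *
      emeasure M {\<omega> \<in> space M. s < X \<omega> \<and> t < Y \<omega>} \<partial>lborel \<partial>lborel)"
proof -
  interpret sigma_finite_measure M by fact
  interpret P: pair_sigma_finite M lborel ..
  \<comment> \<open>For negative \<open>r\<close> both sides vanish, as \<open>ennreal\<close>
    truncates at \<open>0\<close>.\<close>
  have ind: "ennreal r = (\<integral>\<^sup>+s. indicator {0..} s * indicator {..<r} s \<partial>lborel)" for r :: real
  proof -
    have "(\<integral>\<^sup>+s. indicator {0..} s * indicator {..<r} s \<partial>lborel) = (\<integral>\<^sup>+s. indicator {0..<r} s \<partial>lborel)"
      by (intro nn_integral_cong) (auto simp: indicator_def)
    also have "\<dots> = ennreal r"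
      by (cases "0 \<le> r") (auto simp: ennreal_neg)
    finally show ?thesis by simp
  qed
  have "(\<integral>\<^sup>+\<omega>. ennreal (X \<omega>) * ennreal (Y \<omega>) \<partial>M) =
      (\<integral>\<^sup>+\<omega>. \<integral>\<^sup>+s. \<integral>\<^sup>+t. indicator {0..} s * indicator {0..} t *
        (if s < X \<omega> \<and> t < Y \<omega> then 1 else 0) \<partial>lborel \<partial>lborel \<partial>M)"
  proof (intro nn_integral_cong)
    fix \<omega>
    have "ennreal (X \<omega>) * ennreal (Y \<omega>) =
        (\<integral>\<^sup>+s. indicator {0..} s * indicator {..<X \<omega>} s * ennreal (Y \<omega>) \<partial>lborel)"
      by (subst ind[of "X \<omega>"]) (simp add: nn_integral_multc)
    also have "\<dots> = (\<integral>\<^sup>+s. \<integral>\<^sup>+t. indicator {0..} s * indicator {..<X \<omega>} s *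
        (indicator {0..} t * indicator {..<Y \<omega>} t) \<partial>lborel \<partial>lborel)"
      by (subst ind[of "Y \<omega>"]) (simp add: nn_integral_cmult)
    also have "\<dots> = (\<integral>\<^sup>+s. \<integral>\<^sup>+t. indicator {0..} s * indicator {0..} t *
        (if s < X \<omega> \<and> t < Y \<omega> then 1 else 0) \<partial>lborel \<partial>lborel)"
      by (intro nn_integral_cong) (auto simp: indicator_def)
    finally show "ennreal (X \<omega>) * ennreal (Y \<omega>) = \<dots>" .
  qed
  also have "\<dots> = (\<integral>\<^sup>+s. \<integral>\<^sup>+\<omega>. \<integral>\<^sup>+t. indicator {0..} s * indicator {0..} t *
        (if s < X \<omega> \<and> t < Y \<omega> then 1 else 0) \<partial>lborel \<partial>M \<partial>lborel)"
    by (rule P.Fubini'[symmetric]) measurable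
  also have "\<dots> = (\<integral>\<^sup>+s. \<integral>\<^sup>+t. \<integral>\<^sup>+\<omega>. indicator {0..} s * indicator {0..} t *
        (if s < X \<omega> \<and> t < Y \<omega> then 1 else 0) \<partial>M \<partial>lborel \<partial>lborel)"
    by (intro nn_integral_cong P.Fubini'[symmetric]) measurable
  also have "\<dots> = (\<integral>\<^sup>+s. \<integral>\<^sup>+t. indicator {0..} s * indicator {0..} t *
      emeasure M {\<omega> \<in> space M. s < X \<omega> \<and> t < Y \<omega>} \<partial>lborel \<partial>lborel)"
  proof (intro nn_integral_cong)
    fix s t :: real
    have "(\<integral>\<^sup>+\<omega>. indicator {0..} s * indicator {0..} t * (if s < X \<omega> \<and> t < Y \<omega> then 1 else 0) \<partial>M) =
        indicator {0..} s * indicator {0..} t *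
          (\<integral>\<^sup>+\<omega>. indicator {\<omega> \<in> space M. s < X \<omega> \<and> t < Y \<omega>} \<omega> \<partial>M)"
      by (subst nn_integral_cmult[symmetric]) (auto intro!: nn_integral_cong simp: indicator_def)
    then show "(\<integral>\<^sup>+\<omega>. indicator {0..} s * indicator {0..} t * (if s < X \<omega> \<and> t < Y \<omega> then 1 else 0) \<partial>M) =
        indicator {0..} s * indicator {0..} t * emeasure M {\<omega> \<in> space M. s < X \<omega> \<and> t < Y \<omega>}"
      by simp
  qed
  finally show ?thesis .
qed

text \<open>By the layer cake formula it suffices to compare joint superlevel sets. For
  \<open>f\<close> and \<open>g\<close> the two sets are nested by monotonicity, so their
  intersection is the smaller one, and its measure is the largest that the marginals allow.\<close>

lemma nn_integral_mult_le_comonotone: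
  assumes M: "prob_space M" and [measurable]: "X \<in> borel_measurable M" "Y \<in> borel_measurable M"
    and mono: "mono_on {0<..<1} f" "mono_on {0<..<1} g"
    and eq: "distr M borel X = distr unif01 borel f" "distr M borel Y = distr unif01 borel g"
  shows "(\<integral>\<^sup>+\<omega>. ennreal (X \<omega>) * ennreal (Y \<omega>) \<partial>M) \<le> (\<integral>\<^sup>+u. ennreal (f u) * ennreal (g u) \<partial>unif01)"
proof -
  interpret M: prob_space M by fact
  interpret U: prob_space unif01 by (rule prob_space_unif01)
  have [measurable]: "f \<in> borel_measurable unif01" "g \<in> borel_measurable unif01"
    by (auto intro: measurable_unif01_mono mono)
  have "emeasure M {\<omega> \<in> space M. s < X \<omega> \<and> t < Y \<omega>} \<le> emeasure unif01 {u \<in> space unif01. s < f u \<and> t < g u}"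
    for s t
  proof -
    let ?A = "{u \<in> space unif01. s < f u}" and ?B = "{u \<in> space unif01. t < g u}"
    have sp: "space unif01 = {0<..<1}" by (simp add: space_restrict_space)
    have "emeasure M {\<omega> \<in> space M. s < X \<omega>} = emeasure (distr M borel X) {s<..}"
      by (subst emeasure_distr) (auto intro!: arg_cong2[where f=emeasure])
    also have "\<dots> = emeasure unif01 ?A"
      unfolding eq by (subst emeasure_distr) (auto intro!: arg_cong2[where f=emeasure])
    finally have A: "emeasure M {\<omega> \<in> space M. s < X \<omega>} = emeasure unif01 ?A" .
    have "emeasure M {\<omega> \<in> space M. t < Y \<omega>} = emeasure (distr M borel Y) {t<..}"
      by (subst emeasure_distr) (auto intro!: arg_cong2[where f=emeasure])
    also have "\<dots> = emeasure unif01 ?B"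
      unfolding eq by (subst emeasure_distr) (auto intro!: arg_cong2[where f=emeasure])
    finally have B: "emeasure M {\<omega> \<in> space M. t < Y \<omega>} = emeasure unif01 ?B" .
    have "?A \<subseteq> ?B \<or> ?B \<subseteq> ?A"
    proof (rule ccontr)
      assume "\<not> ?thesis"
      then obtain u v where uv: "u \<in> ?A" "u \<notin> ?B" "v \<in> ?B" "v \<notin> ?A" by blast
      then show False
        using mono_onD[OF mono(1), of u v] mono_onD[OF mono(2), of v u] unfolding sp
        by (cases "u \<le> v") auto
    qed
    then consider "{u \<in> space unif01. s < f u \<and> t < g u} = ?A" | "{u \<in> space unif01. s < f u \<and> t < g u} = ?B"
      by blast
    then show ?thesis
    proof cases
      case 1
      show ?thesis unfolding 1 A[symmetric] by (intro emeasure_mono) auto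
    next
      case 2
      show ?thesis unfolding 2 B[symmetric] by (intro emeasure_mono) auto
    qed
  qed
  then show ?thesis
    by (subst (1 2) nn_integral_mult_layer_cake)
      (auto intro!: nn_integral_mono mult_left_mono M.sigma_finite_measure_axioms U.sigma_finite_measure_axioms)
qed

text \<open>The square is expanded with sums on both sides to avoid subtracting infinite values.
  Non-negativity makes \<open>ennreal (X \<omega>) * ennreal (Y \<omega>)\<close> the true product
  and not a truncation.\<close>

lemma nn_integral_square_diff:
  assumes [measurable]: "X \<in> borel_measurable M" "Y \<in> borel_measurable M"
    and "AE \<omega> in M. 0 \<le> X \<omega>" "AE \<omega> in M. 0 \<le> Y \<omega>"
  shows "(\<integral>\<^sup>+\<omega>. ennreal ((X \<omega> - Y \<omega>)\<^sup>2) \<partial>M) + 2 * (\<integral>\<^sup>+\<omega>. ennreal (X \<omega>) * ennreal (Y \<omega>) \<partial>M) =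
    (\<integral>\<^sup>+\<omega>. ennreal ((X \<omega>)\<^sup>2) \<partial>M) + (\<integral>\<^sup>+\<omega>. ennreal ((Y \<omega>)\<^sup>2) \<partial>M)"
proof -
  have "(\<integral>\<^sup>+\<omega>. ennreal ((X \<omega> - Y \<omega>)\<^sup>2) \<partial>M) + 2 * (\<integral>\<^sup>+\<omega>. ennreal (X \<omega>) * ennreal (Y \<omega>) \<partial>M) =
      (\<integral>\<^sup>+\<omega>. ennreal ((X \<omega> - Y \<omega>)\<^sup>2) + 2 * (ennreal (X \<omega>) * ennreal (Y \<omega>)) \<partial>M)"
    by (simp add: nn_integral_add nn_integral_cmult)
  also have "\<dots> = (\<integral>\<^sup>+\<omega>. ennreal ((X \<omega>)\<^sup>2) + ennreal ((Y \<omega>)\<^sup>2) \<partial>M)"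
  proof (intro nn_integral_cong_AE)
    show "AE \<omega> in M. ennreal ((X \<omega> - Y \<omega>)\<^sup>2) + 2 * (ennreal (X \<omega>) * ennreal (Y \<omega>)) =
        ennreal ((X \<omega>)\<^sup>2) + ennreal ((Y \<omega>)\<^sup>2)"
      using assms(3,4)
    proof eventually_elim
      case (elim \<omega>)
      have "ennreal ((X \<omega> - Y \<omega>)\<^sup>2) + 2 * (ennreal (X \<omega>) * ennreal (Y \<omega>)) =
          ennreal ((X \<omega> - Y \<omega>)\<^sup>2) + ennreal (2 * (X \<omega> * Y \<omega>))"
        using elim by (simp add: ennreal_mult)
      also have "\<dots> = ennreal ((X \<omega> - Y \<omega>)\<^sup>2 + 2 * (X \<omega> * Y \<omega>))"
        using elim by simp
      also have "(X \<omega> - Y \<omega>)\<^sup>2 + 2 * (X \<omega> * Y \<omega>) = (X \<omega>)\<^sup>2 + (Y \<omega>)\<^sup>2"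
        by (simp add: power2_eq_square algebra_simps)
      finally show ?case by simp
    qed
  qed
  also have "\<dots> = (\<integral>\<^sup>+\<omega>. ennreal ((X \<omega>)\<^sup>2) \<partial>M) + (\<integral>\<^sup>+\<omega>. ennreal ((Y \<omega>)\<^sup>2) \<partial>M)"
    by (simp add: nn_integral_add)
  finally show ?thesis .
qed

section \<open>Quantile functions and the transport cost\<close>

lemma prob_nonneg_momentD:
  assumes "\<mu> \<in> prob_nonneg_moment 2"
  shows "real_distribution \<mu>" "AE x in \<mu>. 0 \<le> x" "(\<integral>\<^sup>+x. ennreal (x\<^sup>2) \<partial>\<mu>) < \<infinity>"
proof -
  show rd: "real_distribution \<mu>" using assms by (simp add: prob_nonneg_moment_def)
  interpret real_distribution \<mu> by fact
  show "AE x in \<mu>. 0 \<le> x"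
    using assms by (intro AE_I'[of "{..<0}"]) (auto simp: prob_nonneg_moment_def intro!: null_setsI)
  have "integrable \<mu> (\<lambda>x. \<bar>x\<bar> powr 2)" using assms by (simp add: prob_nonneg_moment_def)
  then have "(\<integral>\<^sup>+x. ennreal (norm (\<bar>x\<bar> powr 2)) \<partial>\<mu>) < \<infinity>" by (simp add: integrable_iff_bounded)
  then show "(\<integral>\<^sup>+x. ennreal (x\<^sup>2) \<partial>\<mu>) < \<infinity>" by simp
qed

lemma distr_quantile: "real_distribution \<mu> \<Longrightarrow> distr unif01 borel (quantile \<mu>) = \<mu>"
  using cdf_distribution.distr_I_eq_M[of \<mu>] by (simp add: cdf_distribution_def quantile_def[abs_def])

lemma mono_on_quantile: "real_distribution \<mu> \<Longrightarrow> mono_on {0<..<1} (quantile \<mu>)"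
proof -
  assume "real_distribution \<mu>"
  then interpret cdf_distribution \<mu> by (simp add: cdf_distribution_def)
  show ?thesis using mono_I by (simp add: quantile_def[abs_def])
qed

lemma AE_quantile:
  assumes "real_distribution \<mu>" "AE x in \<mu>. P x"
  shows "AE u in unif01. P (quantile \<mu> u)"
proof -
  have "quantile \<mu> \<in> borel_measurable unif01"
    using assms(1) by (intro measurable_unif01_mono mono_on_quantile)
  moreover have "AE x in distr unif01 borel (quantile \<mu>). P x"
    using assms by (simp only: distr_quantile)
  ultimately show ?thesis by (rule AE_distrD)
qed

text \<open>The marginals fix both second moments, so a small cost means a large integral of the
  product, and this is largest for the comonotone pair of quantile functions.\<close>

lemma transport_cost_ge:
  assumes "\<mu> \<in> prob_nonneg_moment 2" "\<nu> \<in> prob_nonneg_moment 2"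
  shows "(\<integral>\<^sup>+u. ennreal ((quantile \<mu> u - quantile \<nu> u)\<^sup>2) \<partial>unif01) \<le> transport_cost 2 \<mu> \<nu>"
  unfolding transport_cost_def
proof (rule INF_greatest)
  fix \<pi> assume \<pi>: "\<pi> \<in> couplings \<mu> \<nu>"
  note mu = prob_nonneg_momentD[OF assms(1)] and nu = prob_nonneg_momentD[OF assms(2)]
  have [measurable_cong]: "sets \<pi> = sets (borel \<Otimes>\<^sub>M borel)"
    and P: "prob_space \<pi>" and d: "distr \<pi> borel fst = \<mu>" "distr \<pi> borel snd = \<nu>"
    using \<pi> by (auto simp: couplings_def)
  have [measurable]: "quantile \<mu> \<in> borel_measurable unif01" "quantile \<nu> \<in> borel_measurable unif01"
    using mu(1) nu(1) by (auto intro: measurable_unif01_mono mono_on_quantile)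
  have m: "(\<integral>\<^sup>+z. ennreal ((h z)\<^sup>2) \<partial>M) = (\<integral>\<^sup>+x. ennreal (x\<^sup>2) \<partial>distr M borel h)"
    if [measurable]: "h \<in> borel_measurable M" for h and M :: "'c measure"
    by (simp add: nn_integral_distr)
  have AE: "AE z in \<pi>. 0 \<le> fst z" "AE z in \<pi>. 0 \<le> snd z"
    using mu(2) nu(2) unfolding d[symmetric] by (auto simp: AE_distr_iff)
  have AEq: "AE u in unif01. 0 \<le> quantile \<mu> u" "AE u in unif01. 0 \<le> quantile \<nu> u"
    using mu nu by (auto intro: AE_quantile)
  let ?c = "\<lambda>u. ennreal (quantile \<mu> u) * ennreal (quantile \<nu> u)"
  have le: "(\<integral>\<^sup>+z. ennreal (fst z) * ennreal (snd z) \<partial>\<pi>) \<le> (\<integral>\<^sup>+u. ?c u \<partial>unif01)"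
    using mu nu P d by (intro nn_integral_mult_le_comonotone mono_on_quantile) (auto simp: distr_quantile)
  have e1: "(\<integral>\<^sup>+u. ennreal ((quantile \<mu> u - quantile \<nu> u)\<^sup>2) \<partial>unif01) + 2 * (\<integral>\<^sup>+u. ?c u \<partial>unif01) =
      (\<integral>\<^sup>+x. ennreal (x\<^sup>2) \<partial>\<mu>) + (\<integral>\<^sup>+x. ennreal (x\<^sup>2) \<partial>\<nu>)"
    using AEq mu(1) nu(1) by (subst nn_integral_square_diff) (auto simp: m distr_quantile)
  have e2: "(\<integral>\<^sup>+z. ennreal ((fst z - snd z)\<^sup>2) \<partial>\<pi>) + 2 * (\<integral>\<^sup>+z. ennreal (fst z) * ennreal (snd z) \<partial>\<pi>) =
      (\<integral>\<^sup>+x. ennreal (x\<^sup>2) \<partial>\<mu>) + (\<integral>\<^sup>+x. ennreal (x\<^sup>2) \<partial>\<nu>)"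
    using AE by (subst nn_integral_square_diff) (auto simp: m d)
  \<comment> \<open>Cancelling the product integral needs it to be finite, which follows from the
    finite second moments.\<close>
  have "a \<le> b" if "a + 2 * c = m" "b + 2 * e = m" "e \<le> c" "m < \<infinity>" for a b c e m :: ennreal
  proof -
    have "2 * c + a \<le> 2 * c + b"
      using that(1-3) by (metis add.commute add_left_mono mult_left_mono zero_le)
    moreover have "2 * c \<noteq> \<infinity>"
      using that(1,4) by auto
    ultimately show ?thesis
      by (simp only: ennreal_add_left_cancel_le) auto
  qed
  from this[OF e1 e2 le] mu(3) nu(3)
  have "(\<integral>\<^sup>+u. ennreal ((quantile \<mu> u - quantile \<nu> u)\<^sup>2) \<partial>unif01) \<le>
      (\<integral>\<^sup>+z. ennreal ((fst z - snd z)\<^sup>2) \<partial>\<pi>)"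
    by simp
  then show "(\<integral>\<^sup>+u. ennreal ((quantile \<mu> u - quantile \<nu> u)\<^sup>2) \<partial>unif01) \<le>
      (\<integral>\<^sup>+(x, y). ennreal (\<bar>x - y\<bar> powr 2) \<partial>\<pi>)"
    by (simp add: case_prod_beta')
qed

text \<open>The joint law of \<open>f\<close> and \<open>g\<close> under the uniform distribution is
  a coupling with exactly this cost.\<close>

lemma transport_cost_le:
  assumes [measurable]: "f \<in> borel_measurable unif01" "g \<in> borel_measurable unif01"
  shows "transport_cost 2 (distr unif01 borel f) (distr unif01 borel g) \<le>
    (\<integral>\<^sup>+u. ennreal ((f u - g u)\<^sup>2) \<partial>unif01)"
proof -
  interpret U: prob_space unif01 by (rule prob_space_unif01)
  let ?\<pi> = "distr unif01 (borel \<Otimes>\<^sub>M borel) (\<lambda>u. (f u, g u))"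
  have "?\<pi> \<in> couplings (distr unif01 borel f) (distr unif01 borel g)"
    by (auto simp: couplings_def distr_distr o_def intro!: U.prob_space_distr)
  then have "transport_cost 2 (distr unif01 borel f) (distr unif01 borel g) \<le>
      (\<integral>\<^sup>+(x, y). ennreal (\<bar>x - y\<bar> powr 2) \<partial>?\<pi>)"
    unfolding transport_cost_def by (rule INF_lower)
  also have "\<dots> = (\<integral>\<^sup>+u. ennreal ((f u - g u)\<^sup>2) \<partial>unif01)"
    by (subst nn_integral_distr) (auto simp: case_prod_beta')
  finally show ?thesis .
qed

text \<open>The root is strictly increasing on finite costs, and below an infinite cost the other
  one is finite. In contrapositive form, minimality of the distance becomes minimality of the
  cost.\<close>

lemma wasserstein_less:
  assumes "transport_cost 2 \<mu> \<rho> < transport_cost 2 \<nu> \<rho>"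
  shows "wasserstein 2 \<mu> \<rho> < wasserstein 2 \<nu> \<rho>"
proof (cases "transport_cost 2 \<nu> \<rho>")
  case (real r)
  moreover obtain s where s: "0 \<le> s" "transport_cost 2 \<mu> \<rho> = ennreal s"
    using assms by (cases "transport_cost 2 \<mu> \<rho>") auto
  moreover have "s < r" using assms real s by (simp add: ennreal_less_iff)
  moreover from this have "s powr (1 / 2) < r powr (1 / 2)" using s by (intro powr_less_mono2) auto
  ultimately show ?thesis by (simp add: wasserstein_def ennreal_less_iff)
next
  case top
  then show ?thesis using assms by (auto simp: wasserstein_def less_top)
qed

section \<open>Rigidity of the minimizer\<close>

text \<open>A null set cannot contain an interval of positive length.\<close>

lemma AE_unif01_ex_between:
  assumes "AE u in unif01. P u" "0 \<le> a" "a < b" "b \<le> 1"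
  obtains u where "a < u" "u < b" "P u"
proof (rule ccontr)
  assume none: "\<not> thesis"
  obtain N where N: "{u \<in> space unif01. \<not> P u} \<subseteq> N" "emeasure unif01 N = 0" "N \<in> sets unif01"
    using assms(1) by (rule AE_E)
  have "{a<..<b} \<subseteq> N"
    using N(1) none that assms by (force simp: space_restrict_space)
  then have "emeasure unif01 {a<..<b} \<le> 0"
    using N by (metis emeasure_mono)
  moreover have "emeasure unif01 {a<..<b} = ennreal (b - a)"
    using assms by (subst emeasure_restrict_space) auto
  ultimately show False using assms by simp
qed

text \<open>If \<open>f\<close> and \<open>g\<close> differed at \<open>u\<close>, by continuity
  they would differ on an interval to the left of \<open>u\<close>, which is not null.\<close>

lemma AE_unif01_eq_imp_eq:
  fixes f g :: "real \<Rightarrow> real"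
  assumes "AE u in unif01. f u = g u" "continuous_on {0<..<1} f" "continuous_on {0<..<1} g"
    and "u \<in> {0<..<1}"
  shows "f u = g u"
proof (rule ccontr)
  assume "f u \<noteq> g u"
  have "isCont (\<lambda>w. f w - g w) u"
    using assms by (intro continuous_intros) (auto simp: continuous_on_eq_continuous_at)
  then have "\<forall>\<^sub>F w in at u. f w - g w \<noteq> 0"
    using \<open>f u \<noteq> g u\<close> by (intro tendsto_imp_eventually_ne) (auto simp: isCont_def)
  then obtain e where e: "0 < e" "\<And>w. w \<noteq> u \<Longrightarrow> \<bar>w - u\<bar> < e \<Longrightarrow> f w \<noteq> g w"
    by (auto simp: eventually_at dist_real_def)
  obtain w where "max 0 (u - e) < w" "w < u" "f w = g w"
    using assms(1) by (rule AE_unif01_ex_between[of _ "max 0 (u - e)" u]) (use assms e in auto)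
  then show False using e by auto
qed

section \<open>Laws of convex functions as competitors\<close>

lemma convex_on_unit_continuous:
  fixes f :: "real \<Rightarrow> real"
  shows "convex_on {0<..<1} f \<Longrightarrow> continuous_on {0<..<1} f"
  by (intro convex_on_continuous) auto

text \<open>If \<open>y < g u\<close>, left continuity gives some \<open>w < u\<close> with
  \<open>y < g w\<close>, so \<open>g \<le> y\<close> can hold only on \<open>{0<..w}\<close>, of
  mass \<open>w < u\<close>. Hence \<open>g u\<close> is the least point where the distribution
  function reaches \<open>u\<close>.\<close>

lemma quantile_distr_unif01:
  fixes g :: "real \<Rightarrow> real"
  assumes mono: "mono_on {0<..<1} g" and cont: "continuous_on {0<..<1} g" and u: "u \<in> {0<..<1}"
  shows "quantile (distr unif01 borel g) u = g u"
proof -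
  interpret U: prob_space unif01 by (rule prob_space_unif01)
  have g[measurable]: "g \<in> borel_measurable unif01" using mono by (rule measurable_unif01_mono)
  have cdf: "cdf (distr unif01 borel g) y = measure unif01 {v \<in> {0<..<1}. g v \<le> y}" for y
    by (simp add: cdf_def measure_distr space_restrict_space vimage_def Int_def conj_commute)
  have set[measurable]: "{v \<in> {0<..<1}. g v \<le> y} \<in> sets unif01" for y
  proof -
    have "{v \<in> space unif01. g v \<le> y} \<in> sets unif01" by measurable
    then show ?thesis by (simp add: space_restrict_space)
  qed
  have m: "measure unif01 {0<..w} = w" "{0<..w} \<in> sets unif01" if "w \<in> {0<..<1}" for w
    using that by (subst measure_restrict_space, auto simp: sets_restrict_space_iff)
  have "u \<le> cdf (distr unif01 borel g) (g u)"
  proof -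
    have "measure unif01 {0<..u} \<le> measure unif01 {v \<in> {0<..<1}. g v \<le> g u}"
      using u by (intro U.finite_measure_mono set) (auto intro: mono_onD[OF mono])
    then show ?thesis using m u by (simp add: cdf)
  qed
  moreover have "g u \<le> y" if "u \<le> cdf (distr unif01 borel g) y" for y
  proof (rule ccontr)
    assume "\<not> g u \<le> y"
    have "(g \<longlongrightarrow> g u) (at_left u)"
      using cont u by (simp add: continuous_on_eq_continuous_at isCont_def filterlim_at_split)
    then have "\<forall>\<^sub>F w in at_left u. y < g w"
      using \<open>\<not> g u \<le> y\<close> by (intro order_tendstoD) auto
    then have "\<forall>\<^sub>F w in at_left u. y < g w \<and> w \<in> {0<..<u}"
      using eventually_at_left_real[of 0 u] u by (auto elim: eventually_elim2)
    then obtain w where w: "y < g w" "0 < w" "w < u"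
      by (metis (no_types, lifting) eventually_happens' greaterThanLessThan_iff trivial_limit_at_left_real)
    have "v \<le> w" if "v \<in> {0<..<1}" "g v \<le> y" for v
      using mono_onD[OF mono, of w v] that w u by force
    then have "measure unif01 {v \<in> {0<..<1}. g v \<le> y} \<le> measure unif01 {0<..w}"
      using w u m(2)[of w] by (intro U.finite_measure_mono) auto
    then show False using m(1)[of w] w u that by (simp add: cdf)
  qed
  ultimately show ?thesis
    unfolding quantile_def by (intro cInf_eq_minimum) auto
qed

text \<open>On the unit interval \<open>g\<close> is the quantile function of its own law, so the
  conditions defining \<open>F_m2\<close> carry over from the function to the measure.\<close>

lemma distr_unif01_in_F_m2:
  fixes g :: "real \<Rightarrow> real"
  assumes cvx: "convex_on {0<..<1} g" and lim: "(g \<longlongrightarrow> 0) (at_right 0)"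
    and nonneg: "\<And>u. u \<in> {0<..<1} \<Longrightarrow> 0 \<le> g u" and fin: "(\<integral>\<^sup>+u. ennreal ((g u)\<^sup>2) \<partial>unif01) < \<infinity>"
  shows "distr unif01 borel g \<in> F_m2"
proof -
  let ?\<nu> = "distr unif01 borel g"
  interpret U: prob_space unif01 by (rule prob_space_unif01)
  have mono: "mono_on {0<..<1} g" using cvx lim nonneg by (rule convex_on_nonneg_mono)
  have [measurable]: "g \<in> borel_measurable unif01" using mono by (rule measurable_unif01_mono)
  have q: "quantile ?\<nu> u = g u" if "u \<in> {0<..<1}" for u
    using mono convex_on_unit_continuous[OF cvx] that by (rule quantile_distr_unif01)
  have "g -` {..<0} \<inter> space unif01 = {}"
    using nonneg by (force simp: space_restrict_space)
  then have "emeasure ?\<nu> {..<0} = 0"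
    by (simp add: emeasure_distr)
  moreover have "integrable ?\<nu> (\<lambda>x. \<bar>x\<bar> powr 2)"
    using fin by (simp add: integrable_iff_bounded nn_integral_distr)
  ultimately have "?\<nu> \<in> prob_nonneg_moment 2"
    by (simp add: prob_nonneg_moment_def)
  moreover have "convex_on {0<..<1} (quantile ?\<nu>)"
    using cvx q by (rule convex_on_eq)
  moreover have "mono_on {0<..<1} (quantile ?\<nu>)"
    using mono q by (auto simp: mono_on_def)
  moreover have "(quantile ?\<nu> \<longlongrightarrow> 0) (at_right 0)"
    using lim
  proof (rule Lim_transform_eventually)
    show "\<forall>\<^sub>F u in at_right 0. g u = quantile ?\<nu> u"
      using q by (intro eventually_at_rightI[of 0 1]) auto
  qed
  ultimately show ?thesis by (simp add: F_m2_def)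
qed

text \<open>
  Moving the quantile function of the minimizer pointwise towards that of the target cannot
  increase the cost, so it must not change anything.
\<close>

lemma minimizer_rigid:
  assumes min: "is_arg_min (\<lambda>\<nu>. wasserstein 2 \<nu> \<rho>) (\<lambda>\<nu>. \<nu> \<in> F_m2) \<mu>"
    and \<rho>: "\<rho> \<in> prob_nonneg_moment 2"
    and g: "convex_on {0<..<1} g" "(g \<longlongrightarrow> 0) (at_right 0)" "\<And>u. u \<in> {0<..<1} \<Longrightarrow> 0 \<le> g u"
    and between: "AE u in unif01. quantile \<mu> u \<le> g u \<and> g u \<le> quantile \<rho> u \<or>
      quantile \<rho> u \<le> g u \<and> g u \<le> quantile \<mu> u"
    and u: "u \<in> {0<..<1}"
  shows "g u = quantile \<mu> u"
proof -
  let ?Q = "quantile \<mu>" and ?S = "quantile \<rho>" and ?\<nu> = "distr unif01 borel g"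
  have \<mu>F: "\<mu> \<in> F_m2" using min by (simp add: is_arg_min_def)
  then have \<mu>: "\<mu> \<in> prob_nonneg_moment 2" by (simp add: F_m2_def)
  note mu = prob_nonneg_momentD[OF \<mu>] and rho = prob_nonneg_momentD[OF \<rho>]
  have [measurable]: "?Q \<in> borel_measurable unif01" "?S \<in> borel_measurable unif01"
    using mu rho by (auto intro: measurable_unif01_mono mono_on_quantile)
  have [measurable]: "g \<in> borel_measurable unif01"
    by (rule measurable_unif01_mono[OF convex_on_nonneg_mono[OF g]])
  have sq: "(\<integral>\<^sup>+u. ennreal ((quantile \<kappa> u)\<^sup>2) \<partial>unif01) < \<infinity>" if "\<kappa> \<in> prob_nonneg_moment 2" for \<kappa>
  proof -
    note k = prob_nonneg_momentD[OF that]
    have "quantile \<kappa> \<in> borel_measurable unif01" using k by (auto intro: measurable_unif01_mono mono_on_quantile)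
    then have "(\<integral>\<^sup>+x. ennreal (x\<^sup>2) \<partial>distr unif01 borel (quantile \<kappa>)) = (\<integral>\<^sup>+u. ennreal ((quantile \<kappa> u)\<^sup>2) \<partial>unif01)"
      by (simp add: nn_integral_distr)
    then show ?thesis using k by (simp add: distr_quantile)
  qed
  have nonneg: "AE u in unif01. 0 \<le> ?Q u" "AE u in unif01. 0 \<le> ?S u"
    using mu rho by (auto intro: AE_quantile)
  have fin: "(\<integral>\<^sup>+u. ennreal ((?Q u)\<^sup>2) + ennreal ((?S u)\<^sup>2) \<partial>unif01) < \<infinity>"
    using sq[OF \<mu>] sq[OF \<rho>] by (subst nn_integral_add) auto
  \<comment> \<open>A value between two non-negative numbers is bounded by the larger one, which
    makes \<open>g\<close> square integrable.\<close>
  have "AE u in unif01. ennreal ((g u)\<^sup>2) \<le> ennreal ((?Q u)\<^sup>2) + ennreal ((?S u)\<^sup>2)"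
    using between nonneg
  proof eventually_elim
    case (elim u)
    then have "\<bar>g u\<bar> \<le> \<bar>?Q u\<bar> \<or> \<bar>g u\<bar> \<le> \<bar>?S u\<bar>" by auto
    then have "(g u)\<^sup>2 \<le> (?Q u)\<^sup>2 \<or> (g u)\<^sup>2 \<le> (?S u)\<^sup>2" by (simp add: abs_le_square_iff)
    then have "(g u)\<^sup>2 \<le> (?Q u)\<^sup>2 + (?S u)\<^sup>2" by (auto intro: add_increasing add_increasing2)
    then show ?case by (simp flip: ennreal_plus)
  qed
  from le_less_trans[OF nn_integral_mono_AE[OF this] fin]
  have "(\<integral>\<^sup>+u. ennreal ((g u)\<^sup>2) \<partial>unif01) < \<infinity>" .
  then have "?\<nu> \<in> F_m2" using g by (intro distr_unif01_in_F_m2)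
  then have "\<not> wasserstein 2 ?\<nu> \<rho> < wasserstein 2 \<mu> \<rho>"
    using min by (simp add: is_arg_min_def)
  then have "transport_cost 2 \<mu> \<rho> \<le> transport_cost 2 ?\<nu> \<rho>"
    using wasserstein_less by (metis not_le)
  then have ge: "(\<integral>\<^sup>+u. ennreal ((?Q u - ?S u)\<^sup>2) \<partial>unif01) \<le> (\<integral>\<^sup>+u. ennreal ((g u - ?S u)\<^sup>2) \<partial>unif01)"
    using transport_cost_ge[OF \<mu> \<rho>] transport_cost_le[of g ?S] rho(1) by (simp add: distr_quantile)
  \<comment> \<open>A value between \<open>?Q u\<close> and \<open>?S u\<close> is at least as close
    to \<open>?S u\<close> as \<open>?Q u\<close> is.\<close>
  have le: "AE u in unif01. ennreal ((g u - ?S u)\<^sup>2) \<le> ennreal ((?Q u - ?S u)\<^sup>2)"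
    using between
  proof eventually_elim
    case (elim u)
    then have "\<bar>g u - ?S u\<bar> \<le> \<bar>?Q u - ?S u\<bar>" by auto
    then show ?case by (simp add: abs_le_square_iff)
  qed
  have "AE u in unif01. ennreal ((g u - ?S u)\<^sup>2) \<le> ennreal ((?Q u)\<^sup>2) + ennreal ((?S u)\<^sup>2)"
    using between nonneg
  proof eventually_elim
    case (elim u)
    then have "\<bar>g u - ?S u\<bar> \<le> \<bar>?Q u\<bar> \<or> \<bar>g u - ?S u\<bar> \<le> \<bar>?S u\<bar>" by auto
    then have "(g u - ?S u)\<^sup>2 \<le> (?Q u)\<^sup>2 \<or> (g u - ?S u)\<^sup>2 \<le> (?S u)\<^sup>2" by (simp add: abs_le_square_iff)
    then have "(g u - ?S u)\<^sup>2 \<le> (?Q u)\<^sup>2 + (?S u)\<^sup>2" by (auto intro: add_increasing add_increasing2)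
    then show ?case by (simp flip: ennreal_plus)
  qed
  from le_less_trans[OF nn_integral_mono_AE[OF this] fin]
  have fin': "(\<integral>\<^sup>+u. ennreal ((g u - ?S u)\<^sup>2) \<partial>unif01) \<noteq> \<infinity>" by simp
  \<comment> \<open>The pointwise gain has integral \<open>0\<close> by minimality, hence vanishes
    almost everywhere. The integrals may be subtracted because the competitor has finite
    cost.\<close>
  have "(\<integral>\<^sup>+u. ennreal ((?Q u - ?S u)\<^sup>2) - ennreal ((g u - ?S u)\<^sup>2) \<partial>unif01) =
      (\<integral>\<^sup>+u. ennreal ((?Q u - ?S u)\<^sup>2) \<partial>unif01) - (\<integral>\<^sup>+u. ennreal ((g u - ?S u)\<^sup>2) \<partial>unif01)"
    using fin' le by (intro nn_integral_diff) auto
  also have "\<dots> = 0" using ge fin' by (intro diff_eq_0_ennreal) (auto simp: less_top)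
  finally have "AE u in unif01. ennreal ((?Q u - ?S u)\<^sup>2) - ennreal ((g u - ?S u)\<^sup>2) = 0"
    by (subst (asm) nn_integral_0_iff_AE) auto
  then have "AE u in unif01. g u = ?Q u"
    using between le
  proof eventually_elim
    case (elim u)
    then have "(?Q u - ?S u)\<^sup>2 \<le> (g u - ?S u)\<^sup>2"
      by (auto simp: ennreal_minus ennreal_eq_0_iff)
    then have "\<bar>?Q u - ?S u\<bar> \<le> \<bar>g u - ?S u\<bar>" by (simp add: abs_le_square_iff)
    \<comment> \<open>As \<open>g u\<close> lies between \<open>?Q u\<close> and
      \<open>?S u\<close>, it can only be as far from \<open>?S u\<close> as \<open>?Q u\<close> is
      by being equal to \<open>?Q u\<close>.\<close>
    then show ?case using elim(2) by auto
  qed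
  moreover have "continuous_on {0<..<1} ?Q" using \<mu>F by (intro convex_on_unit_continuous) (simp add: F_m2_def)
  ultimately show ?thesis
    using AE_unif01_eq_imp_eq[of g ?Q u] convex_on_unit_continuous[OF g(1)] u by simp
qed

section \<open>The quantile function is piecewise affine\<close>

text \<open>
  \<open>Q\<close> is the quantile function of the minimizer and \<open>S\<close> that of the target measure, whose atoms
  form the set \<open>V\<close>.
\<close>

locale rigid_quantile =
  fixes Q S :: "real \<Rightarrow> real" and V :: "real set" and \<epsilon> :: real
  assumes convex: "convex_on {0<..<1} Q"
    and lim: "(Q \<longlongrightarrow> 0) (at_right 0)"
    and nonneg: "\<And>u. u \<in> {0<..<1} \<Longrightarrow> 0 \<le> Q u"
    and mono_S: "mono_on {0<..<1} S"
    and finite_V: "finite V"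
    and AE_S: "AE u in unif01. S u \<in> V"
    and \<epsilon>_le: "\<And>v. v \<in> V \<Longrightarrow> \<epsilon> \<le> v"
    and \<epsilon>_pos: "0 < \<epsilon>"
    and rigid: "\<And>g u. convex_on {0<..<1} g \<Longrightarrow> (g \<longlongrightarrow> 0) (at_right 0) \<Longrightarrow>
      (\<And>u. u \<in> {0<..<1} \<Longrightarrow> 0 \<le> g u) \<Longrightarrow>
      (AE u in unif01. Q u \<le> g u \<and> g u \<le> S u \<or> S u \<le> g u \<and> g u \<le> Q u) \<Longrightarrow>
      u \<in> {0<..<1} \<Longrightarrow> g u = Q u"
begin

lemma mono_Q: "mono_on {0<..<1} Q"
  using convex lim nonneg by (rule convex_on_nonneg_mono)

lemma cont_Q: "u \<in> {0<..<1} \<Longrightarrow> isCont Q u"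
  using convex_on_unit_continuous[OF convex] by (simp add: continuous_on_eq_continuous_at)

text \<open>The ray stays below \<open>\<epsilon>\<close>, hence below \<open>S\<close> almost
  everywhere, so raising \<open>Q\<close> to it only moves \<open>Q\<close> towards
  \<open>S\<close>. This later bounds the first slope away from \<open>0\<close>.\<close>

lemma Q_ge_linear:
  assumes "u \<in> {0<..<1}"
  shows "\<epsilon> * u \<le> Q u"
proof -
  \<comment> \<open>The summand \<open>0\<close> brings the ray into the form of
    \<open>convex_on_affine_real\<close>.\<close>
  have cvx: "convex_on {0<..<1} (\<lambda>u. max (Q u) (0 + \<epsilon> * u))"
    by (intro convex_on_max convex convex_on_affine_real) simp
  have "max (Q u) (0 + \<epsilon> * u) = Q u"
  proof (rule rigid[of "\<lambda>u. max (Q u) (0 + \<epsilon> * u)"])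
    show "((\<lambda>u. max (Q u) (0 + \<epsilon> * u)) \<longlongrightarrow> 0) (at_right 0)"
      using lim by (auto intro!: tendsto_eq_intros)
    have "AE u in unif01. u \<in> {0<..<1}"
      by (rule AE_unif01I)
    with AE_S show "AE u in unif01. Q u \<le> max (Q u) (0 + \<epsilon> * u) \<and> max (Q u) (0 + \<epsilon> * u) \<le> S u \<or>
        S u \<le> max (Q u) (0 + \<epsilon> * u) \<and> max (Q u) (0 + \<epsilon> * u) \<le> Q u"
    proof eventually_elim
      case (elim u)
      then have "\<epsilon> * u \<le> \<epsilon> * 1" using \<epsilon>_pos by (intro mult_left_mono) auto
      then show ?case using elim \<epsilon>_le[of "S u"] by auto
    qed
  qed (use assms nonneg cvx in \<open>auto simp: max.coboundedI1\<close>)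
  then show ?thesis by linarith
qed

text \<open>The chord over a compact subinterval raises \<open>Q\<close> there, but not beyond
  \<open>v = S\<close>, and lies below \<open>Q\<close> elsewhere; so the maximum of
  \<open>Q\<close> and the chord is an admissible competitor and must equal
  \<open>Q\<close>.\<close>

lemma affine_below:
  assumes "0 \<le> a" "b \<le> 1" and below: "\<And>u. a < u \<Longrightarrow> u < b \<Longrightarrow> S u = v \<and> Q u \<le> v"
  shows "affine_between Q a b"
proof (rule affine_between_locally)
  fix c d assume cd: "a < c" "c < d" "d < b"
  define s where "s = (Q d - Q c) / (d - c)"
  define p where "p = Q c - s * c"
  have mem: "c \<in> {0<..<1}" "d \<in> {0<..<1}" using cd assms by auto
  have L: "p + s * u = Q c + (Q d - Q c) / (d - c) * (u - c)" for u
    by (simp add: p_def s_def[symmetric] algebra_simps)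
  have Qd: "p + s * d = Q d" using cd unfolding L by simp
  have s: "0 \<le> s"
    using mono_onD[OF mono_Q, of c d] mem cd by (simp add: s_def)
  have inside: "Q u \<le> p + s * u" if "u \<in> {c..d}" for u
    unfolding L using that mem cd by (intro convex_on_chord_inside[OF convex]) auto
  have outside: "p + s * u \<le> Q u" if "u \<in> {0<..<1}" "u \<notin> {c..d}" for u
    unfolding L using that mem cd by (intro convex_on_chord_outside[OF convex]) auto
  have cvx: "convex_on {0<..<1} (\<lambda>u. max (Q u) (p + s * u))"
    by (intro convex_on_max convex convex_on_affine_real) simp
  have eq: "max (Q u) (p + s * u) = Q u" if "u \<in> {0<..<1}" for u
  proof (rule rigid[of "\<lambda>u. max (Q u) (p + s * u)"])
    show "((\<lambda>u. max (Q u) (p + s * u)) \<longlongrightarrow> 0) (at_right 0)"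
      using lim
    proof (rule Lim_transform_eventually)
      show "\<forall>\<^sub>F u in at_right 0. Q u = max (Q u) (p + s * u)"
        using mem by (intro eventually_at_rightI[of 0 c]) (auto intro!: max_absorb1[symmetric] outside)
    qed
    show "AE u in unif01. Q u \<le> max (Q u) (p + s * u) \<and> max (Q u) (p + s * u) \<le> S u \<or>
        S u \<le> max (Q u) (p + s * u) \<and> max (Q u) (p + s * u) \<le> Q u"
    proof (rule AE_unif01I)
      fix u :: real assume u: "u \<in> {0<..<1}"
      show "Q u \<le> max (Q u) (p + s * u) \<and> max (Q u) (p + s * u) \<le> S u \<or>
        S u \<le> max (Q u) (p + s * u) \<and> max (Q u) (p + s * u) \<le> Q u"
      proof (cases "u \<in> {c..d}")
        case True
        \<comment> \<open>The chord is non-decreasing, so its greatest value over the subinterval is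
          \<open>Q d\<close>.\<close>
        then have "p + s * u \<le> Q d" using s Qd by (metis add_left_mono atLeastAtMost_iff mult_left_mono)
        moreover have "Q d \<le> v" "S u = v" "Q u \<le> v" using below True cd by auto
        ultimately show ?thesis by auto
      next
        case False
        then show ?thesis using outside[OF u] by auto
      qed
    qed
  qed (use that nonneg cvx in \<open>auto simp: max.coboundedI1\<close>)
  have "Q u = p + s * u" if "u \<in> {c..d}" for u
  proof -
    have "u \<in> {0<..<1}" using that mem by auto
    from eq[OF this] inside[OF that] show ?thesis by simp
  qed
  then show "\<exists>\<alpha> \<beta>. \<forall>u\<in>{c..d}. Q u = \<alpha> + \<beta> * u" by blast
qed

text \<open>
  For \<open>C = 1\<close> there is no tangent at \<open>C\<close>; the second line may then be any affine minorant, in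
  particular the tangent at \<open>A\<close>.
\<close>

lemma eq_max_tangents:
  assumes "0 < A" "A < C" "C \<le> 1"
    and above: "\<And>u. A < u \<Longrightarrow> u < C \<Longrightarrow> S u = v \<and> v < Q u"
    and tangent_A: "p + q * A = Q A" "\<And>u. u \<in> {0<..<1} \<Longrightarrow> p + q * u \<le> Q u"
    and tangent_C: "C < 1 \<Longrightarrow> r + s * C = Q C" "\<And>u. u \<in> {0<..<1} \<Longrightarrow> r + s * u \<le> Q u"
    and u: "A < u" "u < C"
  shows "Q u = max (p + q * u) (r + s * u)"
proof -
  have A: "A \<in> {0<..<1}" using assms by auto
  \<comment> \<open>The strict bound is given only inside the interval; continuity carries its weak
    form to \<open>A\<close>.\<close>
  have "v \<le> Q A"
  proof (rule tendsto_lowerbound)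
    show "(Q \<longlongrightarrow> Q A) (at_right A)"
      using cont_Q[OF A] by (simp add: isCont_def filterlim_at_split)
    show "\<forall>\<^sub>F u in at_right A. v \<le> Q u"
      using above \<open>A < C\<close> by (intro eventually_at_rightI[of A C]) (auto intro: less_imp_le)
  qed simp
  \<comment> \<open>The tangent touches \<open>Q\<close> at \<open>A\<close> and lies below it at
    \<open>A / 2\<close>, where \<open>Q\<close> is at most \<open>Q A\<close>. Here
    \<open>A / 2\<close> is just some point to the left of \<open>A\<close>.\<close>
  have "0 \<le> q"
  proof -
    have "p + q * (A / 2) \<le> Q (A / 2)" using A by (intro tangent_A) auto
    also have "\<dots> \<le> p + q * A"
      using mono_onD[OF mono_Q, of "A / 2" A] A tangent_A by simp
    finally show ?thesis using A by (simp add: zero_le_mult_iff)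
  qed
  define g where "g w = (if A < w \<and> w < C then max (p + q * w) (r + s * w) else Q w)" for w
  have g_le: "g w \<le> Q w" if "w \<in> {0<..<1}" for w
    using that tangent_A tangent_C by (auto simp: g_def)
  have ge1: "p + q * w \<le> g w" if "w \<in> {0<..<1}" for w
    using that tangent_A by (auto simp: g_def)
  have ge2: "r + s * w \<le> g w" if "w \<in> {0<..<1}" for w
    using that tangent_C by (auto simp: g_def)
  \<comment> \<open>The tangent at \<open>A\<close> starts at height at least \<open>v\<close> and
    does not descend, which keeps \<open>g\<close> above \<open>S\<close> between \<open>A\<close>
    and \<open>C\<close>.\<close>
  have v_le: "v \<le> g w" if "A < w" "w < C" for w
  proof -
    have "v \<le> p + q * A" using \<open>v \<le> Q A\<close> tangent_A by simp
    also have "\<dots> \<le> p + q * w" using \<open>0 \<le> q\<close> that by (simp add: mult_left_mono)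
    also have "\<dots> \<le> g w" using that by (simp add: g_def)
    finally show ?thesis .
  qed
  have "g u = Q u"
  proof (rule rigid)
    show "convex_on {0<..<1} g"
    proof (rule convex_on_if_supporting_lines)
      fix w :: real assume w: "w \<in> {0<..<1}"
      have "g A = p + q * A" "C < 1 \<Longrightarrow> g C = r + s * C"
        using tangent_A(1) tangent_C(1) by (auto simp: g_def)
      moreover have "g w = p + q * w \<or> g w = r + s * w" if "A < w" "w < C"
        using that by (simp add: g_def max_def)
      \<comment> \<open>Between the ends, and at them, one of the two lines itself supports
        \<open>g\<close>. Outside, a supporting line of \<open>Q\<close> at \<open>w\<close> has to
        be compared with a tangent.\<close>
      ultimately consider "g w = p + q * w" | "g w = r + s * w" | "w < A" | "C < w"
        using w by (metis greaterThanLessThan_iff linorder_neqE_linordered_idom)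
      then show "\<exists>m. \<forall>z\<in>{0<..<1}. g w + m * (z - w) \<le> g z"
      proof cases
        case 1
        then show ?thesis using ge1 by (intro exI[of _ q]) (auto simp: algebra_simps)
      next
        case 2
        then show ?thesis using ge2 by (intro exI[of _ s]) (auto simp: algebra_simps)
      next
        case 3
        then have gw: "g w = Q w" by (simp add: g_def)
        obtain m where m: "\<And>z. z \<in> {0<..<1} \<Longrightarrow> Q w + m * (z - w) \<le> Q z"
          using convex_on_subgradient[OF convex w] by blast
        have "Q w + m * (z - w) \<le> g z" if z: "z \<in> {0<..<1}" for z
        proof (cases "A < z \<and> z < C")
          case True
          \<comment> \<open>At \<open>A\<close> the supporting line is at most \<open>Q A\<close>,
            the value of the tangent, while at \<open>w < A\<close> it is at least the tangent; so
            beyond \<open>A\<close> it stays below the tangent. The case \<open>C < w\<close> is the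
            mirror image.\<close>
          have "(Q w - m * w - p) + (m - q) * z \<le> 0"
          proof (rule affine_extrapolate[of _ _ A w])
            show "(Q w - m * w - p) + (m - q) * A \<le> 0"
              using m[OF A] tangent_A(1) by (simp add: algebra_simps)
            show "0 \<le> (Q w - m * w - p) + (m - q) * w"
              using tangent_A(2)[OF w] by (simp add: algebra_simps)
          qed (use 3 True in auto)
          then show ?thesis using ge1[OF z] by (simp add: algebra_simps)
        next
          case False
          then have "g z = Q z" by (auto simp: g_def)
          then show ?thesis using m[OF z] by simp
        qed
        then show ?thesis unfolding gw by blast
      next
        case 4
        then have gw: "g w = Q w" by (simp add: g_def)
        have C: "C \<in> {0<..<1}" using 4 w A assms by auto
        obtain m where m: "\<And>z. z \<in> {0<..<1} \<Longrightarrow> Q w + m * (z - w) \<le> Q z"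
          using convex_on_subgradient[OF convex w] by blast
        have "Q w + m * (z - w) \<le> g z" if z: "z \<in> {0<..<1}" for z
        proof (cases "A < z \<and> z < C")
          case True
          have "(Q w - m * w - r) + (m - s) * z \<le> 0"
          proof (rule affine_extrapolate[of _ _ C w])
            show "(Q w - m * w - r) + (m - s) * C \<le> 0"
              using m[OF C] tangent_C(1) C by (simp add: algebra_simps)
            show "0 \<le> (Q w - m * w - r) + (m - s) * w"
              using tangent_C(2)[OF w] by (simp add: algebra_simps)
          qed (use 4 True in auto)
          then show ?thesis using ge2[OF z] by (simp add: algebra_simps)
        next
          case False
          then have "g z = Q z" by (auto simp: g_def)
          then show ?thesis using m[OF z] by simp
        qed
        then show ?thesis unfolding gw by blast
      qed
    qed simp
    show "(g \<longlongrightarrow> 0) (at_right 0)"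
      using lim
    proof (rule Lim_transform_eventually)
      show "\<forall>\<^sub>F w in at_right 0. Q w = g w"
        using A by (intro eventually_at_rightI[of 0 A]) (auto simp: g_def)
    qed
    show "0 \<le> g w" if "w \<in> {0<..<1}" for w
    proof (cases "A < w \<and> w < C")
      case True
      have "0 \<le> p + q * A" using tangent_A nonneg[OF A] by simp
      also have "\<dots> \<le> p + q * w" using \<open>0 \<le> q\<close> True by (simp add: mult_left_mono)
      finally show ?thesis using ge1[OF that] by simp
    qed (use nonneg[OF that] in \<open>auto simp: g_def\<close>)
    show "AE w in unif01. Q w \<le> g w \<and> g w \<le> S w \<or> S w \<le> g w \<and> g w \<le> Q w"
    proof (rule AE_unif01I)
      fix w :: real assume w: "w \<in> {0<..<1}"
      show "Q w \<le> g w \<and> g w \<le> S w \<or> S w \<le> g w \<and> g w \<le> Q w"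
      proof (cases "A < w \<and> w < C")
        case True
        then show ?thesis using above v_le g_le[OF w] by auto
      qed (auto simp: g_def)
    qed
  qed (use u assms in auto)
  then show ?thesis using u by (simp add: g_def)
qed

text \<open>The only possible kink \<open>k\<close> is the crossing point of the two lines whose
  maximum is \<open>Q\<close>.\<close>

lemma affine_above:
  assumes "0 < A" "A < C" "C \<le> 1"
    and above: "\<And>u. A < u \<Longrightarrow> u < C \<Longrightarrow> S u = v \<and> v < Q u"
  shows "\<exists>k. \<forall>a b. A \<le> a \<longrightarrow> b \<le> C \<longrightarrow> k \<notin> {a<..<b} \<longrightarrow> affine_between Q a b"
proof -
  have tangent: "\<exists>p q. p + q * w = Q w \<and> (\<forall>u\<in>{0<..<1}. p + q * u \<le> Q u)" if "w \<in> {0<..<1}" for w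
  proof -
    obtain m where "\<And>z. z \<in> {0<..<1} \<Longrightarrow> Q w + m * (z - w) \<le> Q z"
      using convex_on_subgradient[OF convex \<open>w \<in> {0<..<1}\<close>] by blast
    then show ?thesis
      by (intro exI[of _ "Q w - m * w"] exI[of _ m]) (auto simp: algebra_simps)
  qed
  obtain p q where pq: "p + q * A = Q A" "\<And>u. u \<in> {0<..<1} \<Longrightarrow> p + q * u \<le> Q u"
    using tangent[of A] assms by auto
  obtain r s where rs: "C < 1 \<Longrightarrow> r + s * C = Q C" "\<And>u. u \<in> {0<..<1} \<Longrightarrow> r + s * u \<le> Q u"
    using tangent[of C] assms pq by (cases "C < 1") auto
  show ?thesis
    by (rule affine_between_max_affine) (rule eq_max_tangents[OF assms pq rs])
qed

text \<open>Within a level of \<open>S\<close> the points with \<open>v < Q\<close> form an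
  interval, since \<open>S\<close> and \<open>Q\<close> are monotone. Its ends and the one kink
  inside are the breakpoints; off it the chord argument applies.\<close>

lemma piecewise_affine_on_level:
  assumes "v \<in> V"
  shows "\<exists>B. finite B \<and> (\<forall>a b. 0 \<le> a \<longrightarrow> a < b \<longrightarrow> b \<le> 1 \<longrightarrow> (\<forall>u\<in>{a<..<b}. S u = v) \<longrightarrow>
    B \<inter> {a<..<b} = {} \<longrightarrow> affine_between Q a b)"
proof -
  define K where "K = {u \<in> {0<..<1}. S u = v \<and> v < Q u}"
  have below: "affine_between Q a b"
    if "0 \<le> a" "b \<le> 1" "\<forall>u\<in>{a<..<b}. S u = v" "K \<inter> {a<..<b} = {}" for a b
  proof (rule affine_below)
    fix u assume "a < u" "u < b"
    then have "S u = v" "u \<in> {0<..<1}" "u \<notin> K" using that by auto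
    then show "S u = v \<and> Q u \<le> v" by (auto simp: K_def)
  qed (use that in auto)
  show ?thesis
  proof (cases "K = {}")
    case True
    then show ?thesis using below by (intro exI[of _ "{}"]) auto
  next
    case False
    define A where "A = Inf K"
    define C where "C = Sup K"
    have bdd: "bdd_below K" "bdd_above K"
      by (auto simp: K_def intro!: bdd_belowI[of _ 0] bdd_aboveI[of _ 1])
    have AC: "A \<le> u" "u \<le> C" if "u \<in> K" for u
      using that bdd by (auto simp: A_def C_def intro: cInf_lower cSup_upper)
    have "C \<le> 1" unfolding C_def using False by (intro cSup_least) (auto simp: K_def)
    \<comment> \<open>Near \<open>0\<close> the values of \<open>Q\<close> fall below
      \<open>\<epsilon> \<le> v\<close>, so \<open>K\<close> stays away from \<open>0\<close>, as a
      tangent at \<open>A\<close> requires.\<close>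
    have "0 < A"
    proof -
      have "\<forall>\<^sub>F u in at_right 0. Q u < \<epsilon>" using lim \<epsilon>_pos by (rule order_tendstoD)
      then obtain \<delta> where \<delta>: "0 < \<delta>" "\<And>u. 0 < u \<Longrightarrow> u < \<delta> \<Longrightarrow> Q u < \<epsilon>"
        by (auto simp: eventually_at_right_field)
      have "\<delta> \<le> A" unfolding A_def using False
      proof (rule cInf_greatest)
        fix u assume "u \<in> K"
        then show "\<delta> \<le> u" using \<delta>(2)[of u] \<epsilon>_le[OF assms] by (force simp: K_def)
      qed
      then show ?thesis using \<delta> by simp
    qed
    show ?thesis
    proof (cases "A < C")
      case True
      have "S u = v \<and> v < Q u" if u: "A < u" "u < C" for u
      proof -
        obtain x where x: "x \<in> K" "x < u" using cInf_lessD[OF \<open>K \<noteq> {}\<close>] u(1) unfolding A_def by blast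
        obtain y where y: "y \<in> K" "u < y" using less_cSupD[OF \<open>K \<noteq> {}\<close>] u(2) unfolding C_def by blast
        have "u \<in> {0<..<1}" using x y by (auto simp: K_def)
        then show ?thesis
          using x y mono_onD[OF mono_S, of x u] mono_onD[OF mono_S, of u y] mono_onD[OF mono_Q, of x u]
          by (auto simp: K_def)
      qed
      from affine_above[OF \<open>0 < A\<close> True \<open>C \<le> 1\<close> this]
      obtain k where k: "\<And>a b. A \<le> a \<Longrightarrow> b \<le> C \<Longrightarrow> k \<notin> {a<..<b} \<Longrightarrow> affine_between Q a b" by blast
      show ?thesis
      proof (intro exI[of _ "{A, C, k}"] conjI allI impI)
        fix a b assume ab: "0 \<le> a" "a < b" "b \<le> 1" "\<forall>u\<in>{a<..<b}. S u = v" "{A, C, k} \<inter> {a<..<b} = {}"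
        \<comment> \<open>An interval that avoids \<open>A\<close> and \<open>C\<close> either
          misses the open interval between them or lies in it.\<close>
        then consider "b \<le> A \<or> C \<le> a" | "A \<le> a" "b \<le> C" by force
        then show "affine_between Q a b"
        proof cases
          case 1
          then have "K \<inter> {a<..<b} = {}" using AC by force
          then show ?thesis using below ab by blast
        next
          case 2
          then show ?thesis using k ab by auto
        qed
      qed simp
    next
      case False
      \<comment> \<open>Here \<open>A = C\<close>, so \<open>K\<close> is a single point.\<close>
      show ?thesis
      proof (intro exI[of _ "{A}"] conjI allI impI)
        fix a b assume ab: "0 \<le> a" "a < b" "b \<le> 1" "\<forall>u\<in>{a<..<b}. S u = v" "{A} \<inter> {a<..<b} = {}"
        have "K \<inter> {a<..<b} = {}" using AC ab False by force
        then show "affine_between Q a b" using below ab by blast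
      qed simp
    qed
  qed
qed

text \<open>By monotonicity the level sets of \<open>S\<close> are intervals, and those of the
  finitely many levels in \<open>V\<close> fill the unit interval up to a null set. An interval
  avoiding their ends lies in one level, where the breakpoints of that level apply.\<close>

lemma piecewise_affine:
  obtains B where "finite B"
    "\<And>a b. 0 \<le> a \<Longrightarrow> a < b \<Longrightarrow> b \<le> 1 \<Longrightarrow> B \<inter> {a<..<b} = {} \<Longrightarrow> affine_between Q a b"
proof -
  obtain B where B: "\<And>v. v \<in> V \<Longrightarrow> finite (B v)" "\<And>v a b. v \<in> V \<Longrightarrow> 0 \<le> a \<Longrightarrow> a < b \<Longrightarrow> b \<le> 1 \<Longrightarrow>
      \<forall>u\<in>{a<..<b}. S u = v \<Longrightarrow> B v \<inter> {a<..<b} = {} \<Longrightarrow> affine_between Q a b"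
    using piecewise_affine_on_level by metis
  define J where "J v = {u \<in> {0<..<1}. S u = v}" for v
  have bdd: "bdd_below (J v)" "bdd_above (J v)" for v
    by (auto simp: J_def intro!: bdd_belowI[of _ 0] bdd_aboveI[of _ 1])
  \<comment> \<open>An empty level set contributes unspecified values of \<open>Inf\<close> and
    \<open>Sup\<close>; extra breakpoints do no harm.\<close>
  define B' where "B' = (\<Union>v\<in>V. B v \<union> {Inf (J v), Sup (J v)})"
  show thesis
  proof (rule that[of B'])
    show "finite B'" using B finite_V by (auto simp: B'_def)
    fix a b :: real assume ab: "0 \<le> a" "a < b" "b \<le> 1" "B' \<inter> {a<..<b} = {}"
    \<comment> \<open>Almost every point has its value in \<open>V\<close>, so some point of the
      interval does; its level then contains the whole interval.\<close>
    obtain w where w: "a < w" "w < b" "S w \<in> V"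
      using AE_unif01_ex_between[OF AE_S ab(1-3)] by blast
    define v where "v = S w"
    have wJ: "w \<in> J v" using w ab by (auto simp: J_def v_def)
    have "v \<in> V" using w by (simp add: v_def)
    then have "Inf (J v) \<notin> {a<..<b}" "Sup (J v) \<notin> {a<..<b}" "B v \<inter> {a<..<b} = {}"
      using ab(4) by (auto simp: B'_def)
    moreover have "Inf (J v) \<le> w" "w \<le> Sup (J v)"
      using wJ bdd by (auto intro: cInf_lower cSup_upper)
    ultimately have IS: "Inf (J v) \<le> a" "b \<le> Sup (J v)" using w by auto
    have "S u = v" if u: "u \<in> {a<..<b}" for u
    proof -
      obtain x where x: "x \<in> J v" "x < u" using cInf_lessD[of "J v" u] u IS wJ by auto
      obtain y where y: "y \<in> J v" "u < y" using less_cSupD[of "J v" u] u IS wJ by auto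
      have "u \<in> {0<..<1}" using x y by (auto simp: J_def)
      then show ?thesis
        using x y mono_onD[OF mono_S, of x u] mono_onD[OF mono_S, of u y] by (auto simp: J_def)
    qed
    then show "affine_between Q a b"
      using B(2)[OF \<open>v \<in> V\<close> ab(1-3)] \<open>B v \<inter> {a<..<b} = {}\<close> by blast
  qed
qed

end

section \<open>The density\<close>

lemma strict_mono_on_atMost_Suc:
  fixes t :: "nat \<Rightarrow> 'a::order"
  assumes "\<And>i. i < m \<Longrightarrow> t i < t (Suc i)"
  shows "strict_mono_on {0..m} t"
proof (rule strict_mono_onI)
  fix i j assume "i \<in> {0..m}" "j \<in> {0..m}" "i < j"
  have "Suc i \<le> j" using \<open>i < j\<close> by simp
  then have "j \<le> m \<longrightarrow> t i < t j"
  proof (induction j rule: dec_induct)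
    case base
    show ?case using assms[of i] by simp
  next
    case (step k)
    then show ?case using assms[of k] by (auto intro: less_trans)
  qed
  then show "t i < t j" using \<open>j \<in> {0..m}\<close> by simp
qed

lemma mono_from_Suc:
  fixes t :: "nat \<Rightarrow> 'a::order"
  assumes "\<And>i. Suc i < m \<Longrightarrow> t i \<le> t (Suc i)" "i \<le> j" "j < m"
  shows "t i \<le> t j"
  using assms(2,3)
proof (induction j rule: dec_induct)
  case (step k)
  then show ?case using assms(1)[of k] by (auto intro: order_trans)
qed simp

lemma ex_piece:
  fixes t :: "nat \<Rightarrow> 'a::linorder"
  assumes "t 0 \<le> y" "y < t m"
  obtains i where "i < m" "t i \<le> y" "y < t (Suc i)"
proof -
  have "\<exists>i<m. t i \<le> y \<and> y < t (Suc i)"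
    using assms(2)
  proof (induction m)
    case (Suc m)
    then show ?case by (cases "y < t m") (auto simp: less_Suc_eq not_less)
  qed (use assms in auto)
  then show thesis using that by blast
qed

lemma sum_indicator_piece:
  fixes g :: "nat \<Rightarrow> 'b::comm_semiring_1" and t :: "nat \<Rightarrow> real"
  assumes "strict_mono_on {0..m} t" "i < m" "t i \<le> y" "y < t (Suc i)"
  shows "(\<Sum>j<m. g j * indicator {t j..<t (Suc j)} y) = g i"
proof -
  have "y \<notin> {t j..<t (Suc j)}" if "j < m" "j \<noteq> i" for j
  proof
    assume y: "y \<in> {t j..<t (Suc j)}"
    from \<open>j \<noteq> i\<close> consider "Suc j \<le> i" | "Suc i \<le> j" by linarith
    then show False
    proof cases
      case 1
      then have "t (Suc j) \<le> t i"
        using assms(2) that by (intro strict_mono_on_leD[OF assms(1)]) auto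
      then show False using assms y by auto
    next
      case 2
      then have "t (Suc i) \<le> t j"
        using assms(2) that by (intro strict_mono_on_leD[OF assms(1)]) auto
      then show False using assms y by auto
    qed
  qed
  then have "(\<Sum>j<m. g j * indicator {t j..<t (Suc j)} y) = (\<Sum>j<m. if j = i then g i else 0)"
    using assms by (intro sum.cong) (auto simp: indicator_def)
  then show ?thesis using assms by simp
qed

lemma sum_indicator_outside:
  fixes g :: "nat \<Rightarrow> 'b::comm_semiring_1" and t :: "nat \<Rightarrow> real"
  assumes "strict_mono_on {0..m} t" "y < t 0 \<or> t m \<le> y"
  shows "(\<Sum>j<m. g j * indicator {t j..<t (Suc j)} y) = 0"
proof (intro sum.neutral ballI)
  fix j assume "j \<in> {..<m}"
  then have "t 0 \<le> t j" "t (Suc j) \<le> t m"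
    by (auto intro!: strict_mono_on_leD[OF assms(1)])
  then show "g j * indicator {t j..<t (Suc j)} y = 0"
    using assms(2) by (auto simp: indicator_def)
qed

text \<open>The partition points are those of \<open>B\<close> inside the unit interval together
  with \<open>0\<close> and \<open>1\<close>, in increasing order.\<close>

lemma finite_partition_unit:
  fixes B :: "real set"
  assumes "finite B"
  obtains m u where "1 \<le> m" "u 0 = 0" "u m = 1" "strict_mono_on {0..m} u"
    "\<And>i. i < m \<Longrightarrow> B \<inter> {u i<..<u (Suc i)} = {}"
proof -
  define B' where "B' = (B \<inter> {0<..<1}) \<union> {0, 1}"
  define xs where "xs = sorted_list_of_set B'"
  have fin: "finite B'" using assms by (simp add: B'_def)
  have set: "set xs = B'" using fin by (simp add: xs_def)
  have sorted: "sorted_wrt (<) xs" by (simp add: xs_def)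
  have lt: "xs ! i < xs ! j" if "i < j" "j < length xs" for i j
    using sorted_wrt_nth_less[OF sorted that] .
  have "card {0, 1 :: real} \<le> card B'" using fin by (intro card_mono) (auto simp: B'_def)
  then have len: "2 \<le> length xs" by (simp add: xs_def)
  have range: "0 \<le> xs ! i \<and> xs ! i \<le> 1" if "i < length xs" for i
    using nth_mem[OF that] unfolding set by (auto simp: B'_def)
  have ex: "\<exists>j<length xs. xs ! j = b" if "b \<in> B'" for b
    using that by (simp add: set[symmetric] in_set_conv_nth)
  show thesis
  \<comment> \<open>The pieces are one fewer than the partition points.\<close>
  proof (rule that[of "length xs - 1" "(!) xs"])
    show "1 \<le> length xs - 1" using len by simp
    obtain j where j: "j < length xs" "xs ! j = 0" using ex[of 0] by (auto simp: B'_def)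
    have "j = 0" using lt[of 0 j] j range[of 0] by force
    then show "xs ! 0 = 0" using j by simp
    obtain k where k: "k < length xs" "xs ! k = 1" using ex[of 1] by (auto simp: B'_def)
    have "k = length xs - 1" using lt[of k "length xs - 1"] k range[of "length xs - 1"] by force
    then show "xs ! (length xs - 1) = 1" using k by simp
    show "strict_mono_on {0..length xs - 1} ((!) xs)"
      using len by (intro strict_mono_onI lt) auto
    fix i assume i: "i < length xs - 1"
    have False if b: "b \<in> B" "xs ! i < b" "b < xs ! Suc i" for b
    proof -
      have "i < length xs" "Suc i < length xs" using i by auto
      then have "b \<in> B'" using b range[of i] range[of "Suc i"] by (auto simp: B'_def)
      then obtain l where l: "l < length xs" "xs ! l = b" using ex by blast
      consider "l < i" | "l = i" | "l = Suc i" | "Suc i < l" by linarith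
      then show False
        using b l \<open>i < length xs\<close> lt[of l i] lt[of "Suc i" l] by cases auto
    qed
    then show "B \<inter> {xs ! i<..<xs ! Suc i} = {}" by auto
  qed
qed

text \<open>On a piece where \<open>Q\<close> has slope \<open>d\<close>, the density of the law of \<open>Q\<close> is \<open>1 / d\<close>.\<close>

lemma density_piecewise_affine:
  fixes Q :: "real \<Rightarrow> real"
  assumes convex: "convex_on {0<..<1} Q" and lim: "(Q \<longlongrightarrow> 0) (at_right 0)"
    and ge: "\<And>u. u \<in> {0<..<1} \<Longrightarrow> \<epsilon> * u \<le> Q u" and \<epsilon>: "0 < \<epsilon>"
    and B: "finite B"
      "\<And>a b. 0 \<le> a \<Longrightarrow> a < b \<Longrightarrow> b \<le> 1 \<Longrightarrow> B \<inter> {a<..<b} = {} \<Longrightarrow> affine_between Q a b"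
  shows "\<exists>f :: real \<Rightarrow> real.
      f \<in> borel_measurable borel \<and> (\<forall>y. f y \<ge> 0) \<and> (\<forall>y<0. f y = 0) \<and>
      distr unif01 borel Q = density lborel (\<lambda>y. ennreal (f y)) \<and>
      antimono_on {0..} f \<and>
      compact (closure {y. f y \<noteq> 0}) \<and>
      piecewise_constant f"
proof -
  obtain m u where m: "1 \<le> m" and u0: "u 0 = 0" and um: "u m = 1"
    and u: "strict_mono_on {0..m} u" and gap: "\<And>i. i < m \<Longrightarrow> B \<inter> {u i<..<u (Suc i)} = {}"
    using finite_partition_unit[OF B(1)] by blast
  have u_less: "u i < u (Suc i)" if "i < m" for i
    using that by (intro strict_mono_onD[OF u]) auto
  have u_range: "0 \<le> u i" "u i \<le> 1" if "i \<le> m" for i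
    using strict_mono_on_leD[OF u, of 0 i] strict_mono_on_leD[OF u, of i m] that u0 um by auto
  have "\<exists>c d. \<forall>w\<in>{u i<..<u (Suc i)}. Q w = c + d * w" if "i < m" for i
    using B(2)[of "u i" "u (Suc i)"] u_range[of i] u_range[of "Suc i"] u_less gap that
    by (auto simp: affine_between_def)
  then obtain c d where "\<forall>i. i < m \<longrightarrow> (\<forall>w\<in>{u i<..<u (Suc i)}. Q w = c i + d i * w)"
    by metis
  then have cd: "Q w = c i + d i * w" if "i < m" "u i < w" "w < u (Suc i)" for i w
    using that by auto
  \<comment> \<open>\<open>t i\<close> is the height of \<open>Q\<close> at \<open>u i\<close>. It
    is read off from the piece to the left, because at \<open>u m = 1\<close> only the left limit is
    under control; at \<open>0\<close> the limit of \<open>Q\<close> is \<open>0\<close>.\<close>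
  define t where "t i = (case i of 0 \<Rightarrow> 0 | Suc j \<Rightarrow> c j + d j * u (Suc j))" for i
  have lim_right: "(Q \<longlongrightarrow> c i + d i * u i) (at_right (u i))" if "i < m" for i
  proof (rule Lim_transform_eventually)
    show "((\<lambda>w. c i + d i * w) \<longlongrightarrow> c i + d i * u i) (at_right (u i))"
      by (intro tendsto_intros)
    show "\<forall>\<^sub>F w in at_right (u i). c i + d i * w = Q w"
      using cd u_less that by (intro eventually_at_rightI[of "u i" "u (Suc i)"]) auto
  qed
  have lim_left: "(Q \<longlongrightarrow> t (Suc i)) (at_left (u (Suc i)))" if "i < m" for i
  proof (rule Lim_transform_eventually)
    show "((\<lambda>w. c i + d i * w) \<longlongrightarrow> t (Suc i)) (at_left (u (Suc i)))"
      unfolding t_def nat.case by (intro tendsto_intros)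
    show "\<forall>\<^sub>F w in at_left (u (Suc i)). c i + d i * w = Q w"
      using cd u_less that by (intro eventually_at_leftI[of "u i" "u (Suc i)"]) auto
  qed
  have inner: "u (Suc i) \<in> {0<..<1}" if "Suc i < m" for i
    using strict_mono_onD[OF u, of 0 "Suc i"] strict_mono_onD[OF u, of "Suc i" m] that u0 um by auto
  \<comment> \<open>Continuity at an inner breakpoint makes the affine formulas of the two adjacent
    pieces meet there.\<close>
  have Q_at: "Q (u (Suc i)) = t (Suc i)" "Q (u (Suc i)) = c (Suc i) + d (Suc i) * u (Suc i)"
    if "Suc i < m" for i
  proof -
    have "isCont Q (u (Suc i))"
      using convex_on_continuous[OF _ convex] inner[OF that] by (simp add: continuous_on_eq_continuous_at)
    then have "(Q \<longlongrightarrow> Q (u (Suc i))) (at_left (u (Suc i)))" "(Q \<longlongrightarrow> Q (u (Suc i))) (at_right (u (Suc i)))"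
      by (auto simp: isCont_def filterlim_at_split)
    then show "Q (u (Suc i)) = t (Suc i)" "Q (u (Suc i)) = c (Suc i) + d (Suc i) * u (Suc i)"
      using lim_left[of i] lim_right[of "Suc i"] that
      by (auto intro: tendsto_unique[rotated] trivial_limit_at_left_real trivial_limit_at_right_real)
  qed
  have t_eq: "t i = c i + d i * u i" if "i < m" for i
  proof (cases i)
    case 0
    have "(Q \<longlongrightarrow> c 0 + d 0 * u 0) (at_right 0)" using lim_right[of 0] m u0 by simp
    then have "c 0 + d 0 * u 0 = 0"
      using lim by (rule tendsto_unique[rotated]) simp
    then show ?thesis using 0 by (simp add: t_def)
  next
    case (Suc j)
    then show ?thesis using Q_at[of j] that by simp
  qed
  have t_Suc: "t (Suc i) = c i + d i * u (Suc i)" for i by (simp add: t_def)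
  \<comment> \<open>The chords from the midpoints of two adjacent pieces to their common breakpoint
    have slopes \<open>d i\<close> and \<open>d (Suc i)\<close>; convexity orders them.\<close>
  have d_Suc: "d i \<le> d (Suc i)" if i: "Suc i < m" for i
  proof -
    define x where "x = (u i + u (Suc i)) / 2"
    define y where "y = (u (Suc i) + u (Suc (Suc i))) / 2"
    have x: "u i < x" "x < u (Suc i)" and y: "u (Suc i) < y" "y < u (Suc (Suc i))"
      using u_less[of i] u_less[of "Suc i"] i by (auto simp: x_def y_def)
    have mem: "x \<in> {0<..<1}" "y \<in> {0<..<1}"
      using x y inner[OF i] u_range[of i] u_range[of "Suc (Suc i)"] i by auto
    have "(Q x - Q (u (Suc i))) / (x - u (Suc i)) = d i"
      using cd[of i x] x i Q_at[OF i] t_Suc[of i] by (simp add: field_simps)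
    moreover have "(Q (u (Suc i)) - Q y) / (u (Suc i) - y) = d (Suc i)"
      using cd[of "Suc i" y] y i Q_at(2)[OF i] by (simp add: field_simps)
    ultimately show ?thesis
      using convex_on_slope_le[OF convex mem, of "u (Suc i)"] x y by simp
  qed
  \<comment> \<open>The first piece has intercept \<open>0\<close>, so the lower bound by the ray
    passes to its slope. As slopes increase, all are positive and can be inverted.\<close>
  have "\<epsilon> \<le> d 0"
  proof -
    define w where "w = u 1 / 2"
    have w: "0 < w" "w < u 1" "w < 1" using u_less[of 0] u_range[of 1] u0 m by (auto simp: w_def)
    have "\<epsilon> * w \<le> c 0 + d 0 * w" using ge[of w] cd[of 0 w] w m u0 by simp
    moreover have "c 0 = 0" using t_eq[of 0] m u0 by (simp add: t_def)
    ultimately show ?thesis using w by simp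
  qed
  have d_mono: "d i \<le> d j" if "i \<le> j" "j < m" for i j
    using mono_from_Suc[of m d, OF d_Suc that] .
  have d_pos: "0 < d i" if "i < m" for i
    using d_mono[of 0 i] that \<open>\<epsilon> \<le> d 0\<close> \<epsilon> by simp
  have "t i < t (Suc i)" if "i < m" for i
    using t_eq[OF that] t_Suc[of i] d_pos[OF that] u_less[OF that] by simp
  then have t: "strict_mono_on {0..m} t" by (rule strict_mono_on_atMost_Suc)
  have t0: "t 0 = 0" by (simp add: t_def)

  \<comment> \<open>With half-open pieces exactly one term is non-zero at each point of
    \<open>{0..<t m}\<close>.\<close>
  define f where "f y = (\<Sum>i<m. (1 / d i) * indicator {t i..<t (Suc i)} y)" for y
  have f_piece: "f y = 1 / d i" if "i < m" "t i \<le> y" "y < t (Suc i)" for i y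
    unfolding f_def using t that by (rule sum_indicator_piece)
  have f_out: "f y = 0" if "y < 0 \<or> t m \<le> y" for y
    unfolding f_def using t that t0 by (intro sum_indicator_outside) auto
  have f_nonneg: "0 \<le> f y" for y
    unfolding f_def using d_pos by (intro sum_nonneg mult_nonneg_nonneg) (auto intro: less_imp_le)
  have f_meas[measurable]: "f \<in> borel_measurable borel"
    unfolding f_def[abs_def] by measurable

  have anti: "antimono_on {0..} f"
  proof (rule monotone_onI)
    fix y z :: real assume yz: "y \<in> {0..}" "z \<in> {0..}" "y \<le> z"
    show "f z \<le> f y"
    proof (cases "z < t m")
      case True
      obtain i where i: "i < m" "t i \<le> y" "y < t (Suc i)"
        using ex_piece[of t y m] yz True t0 by auto
      obtain j where j: "j < m" "t j \<le> z" "z < t (Suc j)"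
        using ex_piece[of t z m] yz True t0 by auto
      have "i \<le> j"
      proof (rule ccontr)
        assume "\<not> i \<le> j"
        then have "t (Suc j) \<le> t i" using i by (intro strict_mono_on_leD[OF t]) auto
        then show False using i j yz by simp
      qed
      then have "1 / d j \<le> 1 / d i"
        using d_mono[of i j] d_pos[of i] i j by (intro divide_left_mono) (auto intro: mult_pos_pos d_pos)
      then show ?thesis using f_piece i j by simp
    qed (use f_out f_nonneg in auto)
  qed

  have "{y. f y \<noteq> 0} \<subseteq> {0..t m}"
    using f_out by (force simp: not_less[symmetric])
  then have comp: "compact (closure {y. f y \<noteq> 0})"
    by (simp add: compact_closure bounded_subset[OF bounded_closed_interval])

  have pc: "piecewise_constant f"
    unfolding piecewise_constant_def
  proof (intro exI conjI ballI)
    show "1 \<le> m" "t 0 = 0" "strict_mono_on {0..m} t" by fact+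
    fix i assume "i \<in> {1..m}"
    then show "AE y in lborel. t (i - 1) < y \<and> y < t i \<longrightarrow> f y = 1 / d (i - 1)"
      using f_piece[of "i - 1"] by (intro AE_I2) auto
  next
    show "AE y in lborel. t m < y \<longrightarrow> f y = 0" using f_out by (intro AE_I2) auto
  qed

  have Q_meas: "Q \<in> borel_measurable unif01"
    using ge \<epsilon> by (intro measurable_unif01_mono convex_on_nonneg_mono convex lim)
      (meson greaterThanLessThan_iff less_imp_le mult_pos_pos order_trans)
  have "distr unif01 borel Q = density lborel (\<lambda>y. ennreal (f y))"
  proof (rule measure_eqI)
    fix A :: "real set" assume "A \<in> sets (distr unif01 borel Q)"
    then have A[measurable]: "A \<in> sets borel" by simp
    \<comment> \<open>The substitution \<open>y = c i + d i * w\<close> maps the piece in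
      \<open>u\<close> onto the piece in \<open>t\<close>, and its factor \<open>d i\<close> cancels
      \<open>1 / d i\<close>.\<close>
    have piece: "(\<integral>\<^sup>+w. indicator A (c i + d i * w) * indicator {u i..<u (Suc i)} w \<partial>lborel) =
        (\<integral>\<^sup>+y. ennreal (1 / d i) * indicator {t i..<t (Suc i)} y * indicator A y \<partial>lborel)"
      if i: "i < m" for i
    proof -
      have mem: "c i + d i * w \<in> {t i..<t (Suc i)} \<longleftrightarrow> w \<in> {u i..<u (Suc i)}" for w
        using d_pos[OF i] by (simp add: t_eq[OF i] t_Suc)
      have "(\<integral>\<^sup>+y. ennreal (1 / d i) * indicator {t i..<t (Suc i)} y * indicator A y \<partial>lborel) =
          ennreal \<bar>d i\<bar> * (\<integral>\<^sup>+w. ennreal (1 / d i) * indicator {t i..<t (Suc i)} (c i + d i * w) * indicator A (c i + d i * w) \<partial>lborel)"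
        using d_pos[OF i] by (intro nn_integral_real_affine) auto
      also have "\<dots> = (\<integral>\<^sup>+w. ennreal \<bar>d i\<bar> * (ennreal (1 / d i) * indicator {t i..<t (Suc i)} (c i + d i * w) * indicator A (c i + d i * w)) \<partial>lborel)"
        by (intro nn_integral_cmult[symmetric]) measurable
      also have "\<dots> = (\<integral>\<^sup>+w. indicator A (c i + d i * w) * indicator {u i..<u (Suc i)} w \<partial>lborel)"
      proof (intro nn_integral_cong)
        fix w
        have "ennreal \<bar>d i\<bar> * ennreal (1 / d i) = 1"
          using d_pos[OF i] by (simp flip: ennreal_mult)
        then show "ennreal \<bar>d i\<bar> * (ennreal (1 / d i) * indicator {t i..<t (Suc i)} (c i + d i * w) * indicator A (c i + d i * w)) =
            indicator A (c i + d i * w) * indicator {u i..<u (Suc i)} w"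
          using mem[of w] by (simp add: indicator_def mult.assoc[symmetric])
      qed
      finally show ?thesis ..
    qed
    have "emeasure (distr unif01 borel Q) A = (\<integral>\<^sup>+y. indicator A y \<partial>distr unif01 borel Q)"
      by simp
    also have "\<dots> = (\<integral>\<^sup>+w. indicator A (Q w) \<partial>unif01)"
      using Q_meas by (intro nn_integral_distr) auto
    also have "\<dots> = (\<integral>\<^sup>+w. indicator A (Q w) * indicator {0<..<1} w \<partial>lborel)"
      by (intro nn_integral_restrict_space) simp
    also have "\<dots> = (\<integral>\<^sup>+w. (\<Sum>i<m. indicator A (c i + d i * w) * indicator {u i..<u (Suc i)} w) \<partial>lborel)"
    proof (intro nn_integral_cong_AE)
      \<comment> \<open>The affine formulas hold only inside the pieces, so the finitely many
        breakpoints are removed as a null set.\<close>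
      have "AE w in lborel. w \<notin> u ` {..m}"
        by (intro AE_not_in finite_imp_null_set_lborel) simp
      then show "AE w in lborel. (indicator A (Q w) * indicator {0<..<1} w :: ennreal) =
          (\<Sum>i<m. indicator A (c i + d i * w) * indicator {u i..<u (Suc i)} w)"
      proof eventually_elim
        case (elim w)
        show ?case
        proof (cases "0 \<le> w \<and> w < 1")
          case True
          then obtain i where i: "i < m" "u i \<le> w" "w < u (Suc i)"
            using ex_piece[of u w m] u0 um by auto
          then have "u i < w" using elim by (auto simp: image_iff less_le)
          moreover have "0 \<le> u i" using u_range[of i] i by simp
          ultimately show ?thesis
            using sum_indicator_piece[OF u i, of "\<lambda>i. indicator A (c i + d i * w) :: ennreal"] cd[of i w] i True by simp
        next
          case False
          then show ?thesis
            using sum_indicator_outside[OF u, of w "\<lambda>i. indicator A (c i + d i * w) :: ennreal"] u0 um by auto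
        qed
      qed
    qed
    also have "\<dots> = (\<Sum>i<m. \<integral>\<^sup>+w. indicator A (c i + d i * w) * indicator {u i..<u (Suc i)} w \<partial>lborel)"
      by (intro nn_integral_sum) measurable
    also have "\<dots> = (\<Sum>i<m. \<integral>\<^sup>+y. ennreal (1 / d i) * indicator {t i..<t (Suc i)} y * indicator A y \<partial>lborel)"
      by (intro sum.cong piece) auto
    also have "\<dots> = (\<integral>\<^sup>+y. (\<Sum>i<m. ennreal (1 / d i) * indicator {t i..<t (Suc i)} y * indicator A y) \<partial>lborel)"
      by (intro nn_integral_sum[symmetric]) measurable
    also have "\<dots> = (\<integral>\<^sup>+y. ennreal (f y) * indicator A y \<partial>lborel)"
    proof (intro nn_integral_cong)
      fix y
      have "ennreal (f y) = (\<Sum>i<m. ennreal (1 / d i * indicator {t i..<t (Suc i)} y))"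
        unfolding f_def using d_pos by (intro sum_ennreal[symmetric] mult_nonneg_nonneg) (auto intro: less_imp_le)
      also have "\<dots> = (\<Sum>i<m. ennreal (1 / d i) * indicator {t i..<t (Suc i)} y)"
        by (intro sum.cong) (auto simp: indicator_def)
      finally show "(\<Sum>i<m. ennreal (1 / d i) * indicator {t i..<t (Suc i)} y * indicator A y) =
          ennreal (f y) * indicator A y"
        by (simp only: sum_distrib_right)
    qed
    also have "\<dots> = emeasure (density lborel (\<lambda>y. ennreal (f y))) A"
      by (simp add: emeasure_density)
    finally show "emeasure (distr unif01 borel Q) A = emeasure (density lborel (\<lambda>y. ennreal (f y))) A" .
  qed simp
  then show ?thesis
    using f_meas f_nonneg f_out anti comp pc by blast
qed

section \<open>The empirical measure, and the assembly of the result\<close>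

lemma empirical_measure_AE:
  assumes "n \<ge> 1"
  shows "AE y in empirical_measure n x. y \<in> x ` {1..n}"
proof (rule AE_I'[of "- x ` {1..n}"])
  have "- x ` {1..n} \<in> sets borel"
    by (intro borel_open open_Compl finite_imp_closed) simp
  then show "- x ` {1..n} \<in> null_sets (empirical_measure n x)"
    by (auto simp: null_sets_def emeasure_empirical_measure)
qed auto

text \<open>The measure is carried by finitely many points, so the integrand is almost everywhere
  bounded by a maximum.\<close>

lemma empirical_measure_in_prob_nonneg_moment:
  assumes "n \<ge> 1" "\<And>i. i \<in> {1..n} \<Longrightarrow> x i > 0"
  shows "empirical_measure n x \<in> prob_nonneg_moment 2"
proof -
  let ?\<rho> = "empirical_measure n x"
  have "emeasure ?\<rho> (space ?\<rho>) = (\<Sum>i=1..n. ennreal (1 / real n))"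
    by (simp add: emeasure_empirical_measure)
  also have "\<dots> = ennreal (\<Sum>i=1..n. 1 / real n)" by (intro sum_ennreal) simp
  also have "\<dots> = 1" using assms(1) by simp
  finally interpret prob_space ?\<rho> by (rule prob_spaceI)
  have "real_distribution ?\<rho>" by standard simp
  moreover have "emeasure ?\<rho> {..<0} = 0"
    using assms(2) by (force simp: emeasure_empirical_measure indicator_def)
  moreover have "integrable ?\<rho> (\<lambda>y. \<bar>y\<bar> powr 2)"
  proof (rule integrable_const_bound)
    show "AE y in ?\<rho>. norm (\<bar>y\<bar> powr 2) \<le> Max ((\<lambda>i. \<bar>x i\<bar> powr 2) ` {1..n})"
      using empirical_measure_AE[OF assms(1)] by eventually_elim (auto intro!: Max_ge)
  qed measurable
  ultimately show ?thesis by (simp add: prob_nonneg_moment_def)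
qed

text \<open>Monotonicity puts the limit at \<open>0\<close> below every value.\<close>

lemma nonneg_if_mono_tendsto_0:
  fixes Q :: "real \<Rightarrow> real"
  assumes "mono_on {0<..<1} Q" "(Q \<longlongrightarrow> 0) (at_right 0)" "u \<in> {0<..<1}"
  shows "0 \<le> Q u"
proof (rule tendsto_upperbound[OF assms(2)])
  show "\<forall>\<^sub>F w in at_right 0. Q w \<le> Q u"
    using assms by (intro eventually_at_rightI[of 0 u]) (auto intro: mono_onD)
qed simp

theorem theorem3p6:
  fixes n :: nat and x :: "nat \<Rightarrow> real" and \<mu>_hat :: "real measure"
  assumes "n \<ge> 1"
    and "\<And>i. i \<in> {1..n} \<Longrightarrow> x i > 0"
    and "is_arg_min (\<lambda>\<nu>. wasserstein 2 \<nu> (empirical_measure n x)) (\<lambda>\<nu>. \<nu> \<in> F_m2) \<mu>_hat"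
  shows "\<exists>f :: real \<Rightarrow> real.
      f \<in> borel_measurable borel \<and> (\<forall>y. f y \<ge> 0) \<and> (\<forall>y<0. f y = 0) \<and>
      \<mu>_hat = density lborel (\<lambda>y. ennreal (f y)) \<and>
      antimono_on {0..} f \<and>
      compact (closure {y. f y \<noteq> 0}) \<and>
      piecewise_constant f"
proof -
  let ?\<rho> = "empirical_measure n x"
  let ?V = "x ` {1..n}"
  have \<rho>: "?\<rho> \<in> prob_nonneg_moment 2"
    using assms(1,2) by (rule empirical_measure_in_prob_nonneg_moment)
  have F: "\<mu>_hat \<in> F_m2" using assms(3) by (simp add: is_arg_min_def)
  then have \<mu>: "real_distribution \<mu>_hat" by (simp add: F_m2_def prob_nonneg_moment_def)
  \<comment> \<open>The least data point serves as \<open>\<epsilon>\<close>: it is positive and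
    bounds every atom from below.\<close>
  interpret rigid_quantile "quantile \<mu>_hat" "quantile ?\<rho>" ?V "Min ?V"
  proof
    show "convex_on {0<..<1} (quantile \<mu>_hat)" "(quantile \<mu>_hat \<longlongrightarrow> 0) (at_right 0)"
      using F by (auto simp: F_m2_def)
    show "0 \<le> quantile \<mu>_hat u" if "u \<in> {0<..<1}" for u
      using F that by (intro nonneg_if_mono_tendsto_0) (auto simp: F_m2_def)
    show "mono_on {0<..<1} (quantile ?\<rho>)"
      using prob_nonneg_momentD(1)[OF \<rho>] by (rule mono_on_quantile)
    show "AE u in unif01. quantile ?\<rho> u \<in> ?V"
      using prob_nonneg_momentD(1)[OF \<rho>] empirical_measure_AE[OF assms(1)] by (rule AE_quantile)
    show "finite ?V" by simp
    then show "Min ?V \<le> v" if "v \<in> ?V" for v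
      using that by (rule Min_le)
    show "0 < Min ?V"
      using assms(1,2) by (subst Min_gr_iff) auto
    show "g u = quantile \<mu>_hat u"
      if "convex_on {0<..<1} g" "(g \<longlongrightarrow> 0) (at_right 0)" "\<And>u. u \<in> {0<..<1} \<Longrightarrow> 0 \<le> g u"
        "AE u in unif01. quantile \<mu>_hat u \<le> g u \<and> g u \<le> quantile ?\<rho> u \<or>
          quantile ?\<rho> u \<le> g u \<and> g u \<le> quantile \<mu>_hat u" "u \<in> {0<..<1}" for g u
      using assms(3) \<rho> that by (rule minimizer_rigid)
  qed
  show ?thesis
  proof (rule piecewise_affine)
    fix B assume "finite B"
      "\<And>a b. 0 \<le> a \<Longrightarrow> a < b \<Longrightarrow> b \<le> 1 \<Longrightarrow> B \<inter> {a<..<b} = {} \<Longrightarrow>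
        affine_between (quantile \<mu>_hat) a b"
    \<comment> \<open>The law of the quantile function under the uniform distribution is
      \<open>\<mu>_hat\<close> itself, so the density found for that law is the one sought.\<close>
    from density_piecewise_affine[OF convex lim Q_ge_linear \<epsilon>_pos this] show ?thesis
      unfolding distr_quantile[OF \<mu>] .
  qed
qed

end
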